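(* Let $(Q,\le_Q)$ be a better-quasi-ordering and let $\mathcal{C}$ be the set of all $Q$-labeled countable closed linear orderings ($Q$-cclo's). Then $(\mathcal{C},\preceq)$ is a well-quasi-ordering, where $\preceq$ is $Q$-smc-embeddability.
   Context: **Well- and better-quasi-orderings.** A quasi-ordering is a reflexive transitive relation. A quasi-ordering $Q$ is a well-quasi-ordering (wqo) if for every infinite sequence $\langle p_n: n<\omega\rangle$ in $Q$ there are $n<k$ with $p_n\le p_k$. For a finite $c\subseteq\mathbb{N}$ and any $d\subseteq\mathbb{N}$, $c$ is an initial segment of $d$ if $c=\{i\in d: i\le\max c\}$. An infinite set $B$ of finite subsets of $\mathbb{N}$ is a block if every infinite $X\subseteq\bigcup B$ has an initial segment in $B$; a block is a barrier if no two distinct elements of $B$ are comparable with respect to inclusion. For $b_1,b_2\in B$ write $b_1\vartriangleleft b_2$ if there are $i_1<i_2<\dots<i_m$ and $k$ with $1\le k<m$ such that $b_1=\{i_1,\dots,i_k\}$ and $b_2=\{i_2,\dots,i_m\}$. $Q$ is a better-quasi-ordering (bqo) if for every barrier $B$ and every $f:B\to Q$ there are $b_1,b_2\in B$ with $b_1\vartriangleleft b_2$ and $f(b_1)\le f(b_2)$. **$Q$-cclo's.** A countable closed linear ordering (cclo) is a countable closed subset of $\mathbb{R}$. A smc embedding (strictly monotone continuous embedding) between cclo's $V_1,V_2$ is a map $h:V_1\to V_2$ that is strictly increasing and such that whenever $p_n\in V_1$ converges in $\mathbb{R}$ to $p\in V_1$, then $h(p_n)$ converges to $h(p)$. A $Q$-cclo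 is a function $A$ whose domain $\operatorname{dom}A$ is a cclo and whose range is contained in $Q$. For $Q$-cclo's, $A\preceq B$ means that there is a smc embedding $h:\operatorname{dom}A\to\operatorname{dom}B$ with $A(a)\le_Q B(h(a))$ for all $a\in\operatorname{dom}A$. *)

theory Defs
  imports "HOL-Analysis.Analysis"
begin

definition quasi_order_on :: "'a set \<Rightarrow> ('a \<Rightarrow> 'a \<Rightarrow> bool) \<Rightarrow> bool" where
  "quasi_order_on Q le \<longleftrightarrow> reflp_on Q le \<and> transp_on Q le"

definition wqo_on :: "'a set \<Rightarrow> ('a \<Rightarrow> 'a \<Rightarrow> bool) \<Rightarrow> bool" where
  "wqo_on Q le \<longleftrightarrow> quasi_order_on Q le \<and>
     (\<forall>p :: nat \<Rightarrow> 'a. (\<forall>n. p n \<in> Q) \<longrightarrow> (\<exists>n k. n < k \<and> le (p n) (p k)))"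

(* The guard "c \<noteq> {}" only keeps the unspecified value Max {} out of play: the empty set
   counts as an initial segment of every set.  This has no effect on barriers, which never
   contain the empty set (it would be comparable with all other elements). *)
definition initial_segment :: "nat set \<Rightarrow> nat set \<Rightarrow> bool" where
  "initial_segment c d \<longleftrightarrow> finite c \<and> c = {i \<in> d. c \<noteq> {} \<and> i \<le> Max c}"

definition block :: "nat set set \<Rightarrow> bool" where
  "block B \<longleftrightarrow> infinite B \<and> (\<forall>b\<in>B. finite b) \<and>
     (\<forall>X. infinite X \<and> X \<subseteq> \<Union>B \<longrightarrow> (\<exists>b\<in>B. initial_segment b X))"

definition barrier :: "nat set set \<Rightarrow> bool" where
  "barrier B \<longleftrightarrow> block B \<and> (\<forall>b\<in>B. \<forall>c\<in>B. b \<noteq> c \<longrightarrow> \<not> b \<subseteq> c)"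

definition shift_rel :: "nat set \<Rightarrow> nat set \<Rightarrow> bool" where
  "shift_rel b1 b2 \<longleftrightarrow> (\<exists>(i :: nat \<Rightarrow> nat) k m. 1 \<le> k \<and> k < m \<and>
     strict_mono_on {1..m} i \<and> b1 = i ` {1..k} \<and> b2 = i ` {2..m})"

definition bqo_on :: "'a set \<Rightarrow> ('a \<Rightarrow> 'a \<Rightarrow> bool) \<Rightarrow> bool" where
  "bqo_on Q le \<longleftrightarrow> quasi_order_on Q le \<and>
     (\<forall>B (f :: nat set \<Rightarrow> 'a). barrier B \<and> f ` B \<subseteq> Q \<longrightarrow>
        (\<exists>b1\<in>B. \<exists>b2\<in>B. shift_rel b1 b2 \<and> le (f b1) (f b2)))"

definition cclo :: "real set \<Rightarrow> bool" where
  "cclo V \<longleftrightarrow> countable V \<and> closed V"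

(* Only the values of h on V1 matter. *)
definition smc_embedding :: "real set \<Rightarrow> real set \<Rightarrow> (real \<Rightarrow> real) \<Rightarrow> bool" where
  "smc_embedding V1 V2 h \<longleftrightarrow> h ` V1 \<subseteq> V2 \<and> strict_mono_on V1 h \<and>
     (\<forall>(p :: nat \<Rightarrow> real) x. (\<forall>n. p n \<in> V1) \<and> x \<in> V1 \<and> p \<longlonglongrightarrow> x \<longrightarrow>
        (\<lambda>n. h (p n)) \<longlonglongrightarrow> h x)"

(* A labelled cclo is a partial function on the reals, so that its domain is part of it. *)
definition labelled_cclos :: "'a set \<Rightarrow> (real \<rightharpoonup> 'a) set" where
  "labelled_cclos Q = {A. cclo (dom A) \<and> ran A \<subseteq> Q}"

definition smc_embeddable ::
    "('a \<Rightarrow> 'a \<Rightarrow> bool) \<Rightarrow> (real \<rightharpoonup> 'a) \<Rightarrow> (real \<rightharpoonup> 'a) \<Rightarrow> bool" where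
  "smc_embeddable le A B \<longleftrightarrow> (\<exists>h. smc_embedding (dom A) (dom B) h \<and>
     (\<forall>a \<in> dom A. le (the (A a)) (the (B (h a)))))"

end

theory Submission
  imports Defs
begin

text \<open>The proof follows Nash-Williams and Laver: a well-founded coding by trees together with a minimal
  bad array argument.

  \<^bold>\<open>Arrays.\<close>  For an infinite \<open>A \<subseteq> \<nat>\<close> consider functions \<open>F\<close> on the infinite subsets \<open>X\<close> of \<open>A\<close> that depend
  only on a finite initial part of \<open>X\<close>.  Such an array is bad if \<open>F X \<le> F (tail X)\<close> fails for all \<open>X\<close>,
  where \<open>tail X\<close> is \<open>X\<close> without its least element.  A better-quasi-ordering, defined by barriers, has
  no bad array (\<open>bqo_on_no_bad_array\<close>): by the Nash-Williams partition theorem (\<open>open_Ramsey\<close>), the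
  inclusion-minimal initial parts on which \<open>F\<close> is decided contain a barrier.  Conversely, a
  quasi-ordering without bad arrays is a well-quasi-ordering: a bad sequence \<open>p\<close> gives the bad array
  \<open>X \<mapsto> p (min X)\<close>.

  \<^bold>\<open>Structure.\<close>  Call a labelled set decomposed if it is empty, or consists of a first part, a sequence
  of parts that increases to a point \<open>x\<close>, the point \<open>x\<close>, a sequence of parts that decreases to \<open>x\<close>,
  and a last part, all of them again decomposed, such that each member of the two sequences
  embeds in infinitely many members of the same sequence.  If the labels of the two points \<open>x\<close> and
  \<open>y\<close> of two such sets compare and every part of the first set embeds in some corresponding part of
  the second, then the embeddings of the parts can be glued to a continuous one
  (\<open>Node_embeddable\<close>): recurrence lets the images of the parts move towards \<open>y\<close>.

  \<^bold>\<open>No bad array of decomposed sets.\<close>  Decomposed sets carry well-founded trees, and a part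
  of a set embeds in the set.  So a bad array of decomposed sets would yield a minimal one
  (\<open>minimal_bad_array\<close>).  By Ramsey, on a smaller domain it would fail always for the same reason:
  because of the labels, which contradicts the assumption on \<open>Q\<close>, or because some part of \<open>F X\<close>
  embeds in no corresponding part of \<open>F (tail X)\<close>; choosing these parts gives a smaller bad array.

  \<^bold>\<open>Every bounded labelled cclo is decomposed\<close> (\<open>bounded_cclo_decomposable\<close>).  The points without
  a neighbourhood whose intervals can all be decomposed form a countable closed set.  If it is nonempty,
  then it has an isolated point by the Baire category theorem.  All other points near this point are
  harmless, so the set splits near it into sequences of decomposed parts, and these are eventually
  recurrent since decomposed sets are well-quasi-ordered.  Finally, an arbitrary cclo
  is mapped to a bounded one by the arc tangent, with the two end points added.\<close>

section \<open>Homogeneous sets for open partitions\<close>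

text \<open>The infinite subsets of \<open>A\<close>, the arguments of the partitions and arrays below.\<close>

definition inf_subsets :: "nat set \<Rightarrow> nat set set" where
  "inf_subsets A = {X. X \<subseteq> A \<and> infinite X}"

text \<open>\<open>X\<close> and \<open>Y\<close> have the same elements up to \<open>m\<close>.  The sets that agree with \<open>X\<close> in this way form a
  basic neighbourhood of \<open>X\<close>.\<close>

definition agree :: "nat \<Rightarrow> nat set \<Rightarrow> nat set \<Rightarrow> bool" where
  "agree m X Y \<longleftrightarrow> X \<inter> {..m} = Y \<inter> {..m}"

text \<open>\<open>P\<close> is decided, at each infinite subset of \<open>A\<close>, by an initial part of this subset.\<close>

definition clopen_on :: "nat set \<Rightarrow> (nat set \<Rightarrow> bool) \<Rightarrow> bool" where
  "clopen_on A P \<longleftrightarrow>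
     (\<forall>X\<in>inf_subsets A. \<exists>m. \<forall>Y\<in>inf_subsets A. agree m X Y \<longrightarrow> P Y = P X)"

text \<open>The numbers greater than all elements of \<open>s\<close>; all numbers if \<open>s\<close> is empty.\<close>

definition beyond :: "nat set \<Rightarrow> nat set" where
  "beyond s = {x. \<forall>y\<in>s. y < x}"

lemma inf_subsets_mono: "B \<subseteq> A \<Longrightarrow> inf_subsets B \<subseteq> inf_subsets A"
  by (auto simp: inf_subsets_def)

lemma infinite_Int_beyond:
  assumes "infinite M" "finite s" shows "infinite (M \<inter> beyond s)"
proof -
  have "M - {..Max (insert 0 s)} \<subseteq> M \<inter> beyond s"
    using assms(2) by (auto simp: beyond_def not_le)
  moreover have "infinite (M - {..Max (insert 0 s)})" using assms(1) by simp
  ultimately show ?thesis using finite_subset by blast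
qed

text \<open>Fusion: if \<open>D s M\<close> depends only on the part of \<open>M\<close> beyond \<open>s\<close>, is inherited by smaller \<open>M\<close>, and can be
  achieved for each single \<open>s\<close> by shrinking \<open>M\<close>, then it can be achieved for all finite subsets
  \<open>s\<close> of one infinite set at once.\<close>

lemma fusion:
  fixes D :: "nat set \<Rightarrow> nat set \<Rightarrow> bool"
  assumes her: "\<And>s M N. \<lbrakk>D s M; N \<inter> beyond s \<subseteq> M\<rbrakk> \<Longrightarrow> D s N"
    and dense: "\<And>s M. \<lbrakk>finite s; infinite M; M \<subseteq> M0\<rbrakk> \<Longrightarrow> \<exists>N\<subseteq>M. infinite N \<and> D s N"
    and inf: "infinite M0"
  shows "\<exists>N\<subseteq>M0. infinite N \<and> (\<forall>s. finite s \<and> s \<subseteq> N \<longrightarrow> D s N)"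
proof -
  \<comment> \<open>Finitely many sets \<open>s\<close> can be treated one after the other.\<close>
  have fin: "\<exists>N\<subseteq>M. infinite N \<and> (\<forall>s\<in>S. D s N)"
    if "finite S" "\<forall>s\<in>S. finite s" "infinite M" "M \<subseteq> M0" for S M
    using that
  proof (induction S)
    case empty
    then show ?case by auto
  next
    case (insert s S)
    then obtain N where N: "N \<subseteq> M" "infinite N" "\<forall>s\<in>S. D s N" by auto
    obtain N' where N': "N' \<subseteq> N" "infinite N'" "D s N'"
      using dense[of s N] N insert.prems by auto
    have "\<forall>s\<in>S. D s N'" using her N(3) N'(1) by blast
    then show ?case using N N' by (intro exI[of _ N']) auto
  qed
  \<comment> \<open>The least elements of a sequence \<open>f 0 \<supseteq> f 1 \<supseteq> ...\<close> form the set sought; when \<open>f (Suc n)\<close> is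
    chosen, all \<open>s\<close> below the least element of \<open>f n\<close> are treated.\<close>
  have "\<exists>f :: nat \<Rightarrow> nat set. \<forall>n. (infinite (f n) \<and> f n \<subseteq> M0 \<and> (n = 0 \<longrightarrow> D {} (f n))) \<and>
      (f (Suc n) \<subseteq> f n \<inter> beyond {Inf (f n)} \<and> (\<forall>s. s \<subseteq> {..Inf (f n)} \<longrightarrow> D s (f (Suc n))))"
  proof (rule dependent_nat_choice)
    show "\<exists>M. infinite M \<and> M \<subseteq> M0 \<and> ((0::nat) = 0 \<longrightarrow> D {} M)"
      using dense[of "{}" M0] inf by auto
  next
    fix M :: "nat set" and n :: nat
    assume M: "infinite M \<and> M \<subseteq> M0 \<and> (n = 0 \<longrightarrow> D {} M)"
    let ?a = "Inf M"
    have "infinite (M \<inter> beyond {?a})" using M infinite_Int_beyond by blast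
    moreover have "\<forall>s\<in>Pow {..?a}. finite s" by (auto intro: finite_subset)
    moreover have "M \<inter> beyond {?a} \<subseteq> M0" using M by blast
    ultimately obtain N where "N \<subseteq> M \<inter> beyond {?a}" "infinite N" "\<forall>s\<in>Pow {..?a}. D s N"
      using fin[of "Pow {..?a}" "M \<inter> beyond {?a}"] by auto
    then show "\<exists>N. (infinite N \<and> N \<subseteq> M0 \<and> (Suc n = 0 \<longrightarrow> D {} N)) \<and>
        (N \<subseteq> M \<inter> beyond {?a} \<and> (\<forall>s. s \<subseteq> {..?a} \<longrightarrow> D s N))"
      using M by (intro exI[of _ N]) auto
  qed
  then obtain f where f: "\<forall>n. (infinite (f n) \<and> f n \<subseteq> M0 \<and> (n = 0 \<longrightarrow> D {} (f n))) \<and>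
      (f (Suc n) \<subseteq> f n \<inter> beyond {Inf (f n)} \<and> (\<forall>s. s \<subseteq> {..Inf (f n)} \<longrightarrow> D s (f (Suc n))))" ..
  have f_inf: "infinite (f n)" and f_Suc: "f (Suc n) \<subseteq> f n \<inter> beyond {Inf (f n)}"
    and f_sub: "f n \<subseteq> M0" for n
    using f by blast+
  have f_D: "D s (f (Suc n))" if "s \<subseteq> {..Inf (f n)}" for n s using f that by blast
  have f0: "D {} (f 0)" using f by blast
  define a where "a n = Inf (f n)" for n
  have a_in: "a n \<in> f n" for n
    unfolding a_def using f_inf[of n] by (metis Inf_nat_def1 finite.emptyI)
  have f_anti: "f n \<subseteq> f m" if "m \<le> n" for m n
    using f_Suc by (intro lift_Suc_antimono_le[OF _ that]) blast
  have a_less: "a m < a n" if "m < n" for m n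
  proof -
    have "a n \<in> f (Suc m)" using a_in f_anti[of "Suc m" n] that by auto
    then show ?thesis using f_Suc[of m] by (auto simp: beyond_def a_def)
  qed
  then have sm: "strict_mono a" by (simp add: strict_mono_def)
  define N where "N = range a"
  have "N \<subseteq> M0" using a_in f_sub by (auto simp: N_def)
  moreover have "infinite N"
    unfolding N_def using sm by (simp add: finite_image_iff strict_mono_imp_inj_on)
  moreover have "D s N" if s: "finite s" "s \<subseteq> N" for s
  proof (cases "s = {}")
    case True
    then show ?thesis using her[OF f0, of N] a_in f_anti[of 0] by (auto simp: N_def)
  next
    case False
    obtain n where n: "Max s = a n" using s False Max_in by (metis N_def imageE subset_eq)
    have "s \<subseteq> {..a n}" using s(1) by (auto simp flip: n)
    then have D: "D s (f (Suc n))" using f_D by (simp add: a_def)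
    have "N \<inter> beyond s \<subseteq> f (Suc n)"
    proof
      fix x assume x: "x \<in> N \<inter> beyond s"
      then obtain k where k: "x = a k" by (auto simp: N_def)
      have "a n \<in> s" using n s False Max_in by metis
      then have "a n < a k" using x k by (auto simp: beyond_def)
      then have "n < k" using sm strict_mono_less by blast
      then show "x \<in> f (Suc n)" using k a_in f_anti[of "Suc n" k] by auto
    qed
    then show ?thesis using her D by blast
  qed
  ultimately show ?thesis by blast
qed

text \<open>Nash-Williams' notions: \<open>M\<close> accepts \<open>s\<close> if all continuations of \<open>s\<close> within \<open>M\<close> satisfy \<open>P\<close>, and rejects
  \<open>s\<close> if no infinite subset of \<open>M\<close> accepts \<open>s\<close>.\<close>

definition accepts :: "(nat set \<Rightarrow> bool) \<Rightarrow> nat set \<Rightarrow> nat set \<Rightarrow> bool" where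
  "accepts P s M \<longleftrightarrow> (\<forall>X\<in>inf_subsets (M \<inter> beyond s). P (s \<union> X))"

definition rejects :: "(nat set \<Rightarrow> bool) \<Rightarrow> nat set \<Rightarrow> nat set \<Rightarrow> bool" where
  "rejects P s M \<longleftrightarrow> (\<forall>N\<subseteq>M. infinite N \<longrightarrow> \<not> accepts P s N)"

lemma accepts_mono: "\<lbrakk>accepts P s M; N \<inter> beyond s \<subseteq> M\<rbrakk> \<Longrightarrow> accepts P s N"
  unfolding accepts_def inf_subsets_def by blast

lemma rejects_mono: "\<lbrakk>rejects P s M; N \<inter> beyond s \<subseteq> M; finite s\<rbrakk> \<Longrightarrow> rejects P s N"
  unfolding rejects_def
proof (intro allI impI notI)
  fix N' assume rej: "\<forall>N\<subseteq>M. infinite N \<longrightarrow> \<not> accepts P s N" and sub: "N \<inter> beyond s \<subseteq> M"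
    and s: "finite s" and N': "N' \<subseteq> N" "infinite N'" "accepts P s N'"
  have "accepts P s (N' \<inter> beyond s)" by (rule accepts_mono[OF N'(3)]) auto
  moreover have "infinite (N' \<inter> beyond s)" using infinite_Int_beyond[OF N'(2) s] .
  moreover have "N' \<inter> beyond s \<subseteq> M" using sub N'(1) by auto
  ultimately show False using rej by auto
qed

text \<open>The partition theorem of Nash-Williams: open sets are Ramsey.\<close>

theorem open_Ramsey:
  assumes A: "infinite A"
    and op: "\<And>X. X \<in> inf_subsets A \<Longrightarrow> P X \<Longrightarrow> \<exists>m. \<forall>Y\<in>inf_subsets A. agree m X Y \<longrightarrow> P Y"
  shows "\<exists>B\<in>inf_subsets A. (\<forall>X\<in>inf_subsets B. P X) \<or> (\<forall>X\<in>inf_subsets B. \<not> P X)"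
proof -
  have "\<exists>N\<subseteq>A. infinite N \<and> (\<forall>s. finite s \<and> s \<subseteq> N \<longrightarrow>
      (finite s \<longrightarrow> accepts P s N \<or> rejects P s N))"
  proof (rule fusion)
    fix s M N assume "finite s \<longrightarrow> accepts P s M \<or> rejects P s M" "N \<inter> beyond s \<subseteq> M"
    then show "finite s \<longrightarrow> accepts P s N \<or> rejects P s N"
      using accepts_mono[of P s M N] rejects_mono[of P s M N] by blast
  next
    fix s M :: "nat set" assume "finite s" "infinite M"
    show "\<exists>N\<subseteq>M. infinite N \<and> (finite s \<longrightarrow> accepts P s N \<or> rejects P s N)"
    proof (cases "rejects P s M")
      case True
      then show ?thesis using \<open>infinite M\<close> by (intro exI[of _ M]) simp
    next
      case False
      then obtain N where "N \<subseteq> M" "infinite N" "accepts P s N" by (auto simp: rejects_def)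
      then show ?thesis by (intro exI[of _ N]) simp
    qed
  qed (rule A)
  then obtain M where M: "M \<subseteq> A" "infinite M"
    and dec: "\<And>s. finite s \<Longrightarrow> s \<subseteq> M \<Longrightarrow> accepts P s M \<or> rejects P s M"
    by (elim exE conjE) simp
  show ?thesis
  proof (cases "accepts P {} M")
    case True
    then have "\<forall>X\<in>inf_subsets M. P X" by (auto simp: accepts_def beyond_def)
    then show ?thesis using M by (intro bexI[of _ M]) (auto simp: inf_subsets_def)
  next
    case False
    then have rej0: "rejects P {} M" using dec by auto
    \<comment> \<open>If \<open>s\<close> is rejected, then almost all one-point continuations of \<open>s\<close> are rejected as well.\<close>
    define D where "D s N \<longleftrightarrow> (finite s \<longrightarrow> s \<subseteq> M \<longrightarrow> rejects P s M \<longrightarrow>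
        (\<forall>n\<in>N \<inter> beyond s. rejects P (insert n s) M))" for s N
    have "\<exists>N\<subseteq>M. infinite N \<and> (\<forall>s. finite s \<and> s \<subseteq> N \<longrightarrow> D s N)"
    proof (rule fusion)
      fix s K N assume "D s K" "N \<inter> beyond s \<subseteq> K"
      then show "D s N" unfolding D_def by blast
    next
      fix s K :: "nat set" assume s: "finite s" and K: "infinite K" "K \<subseteq> M"
      show "\<exists>N\<subseteq>K. infinite N \<and> D s N"
      proof (cases "s \<subseteq> M \<and> rejects P s M")
        case False
        then show ?thesis using K by (auto simp: D_def)
      next
        case True
        define E where "E = {n \<in> K \<inter> beyond s. accepts P (insert n s) M}"
        have "finite E"
        proof (rule ccontr)
          assume infE: "infinite E"
          have "accepts P s E"
            unfolding accepts_def
          proof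
            fix X assume X: "X \<in> inf_subsets (E \<inter> beyond s)"
            define n where "n = Inf X"
            have "X \<noteq> {}" using X by (auto simp: inf_subsets_def)
            then have nX: "n \<in> X" by (simp add: n_def Inf_nat_def1)
            then have acc: "accepts P (insert n s) M" using X by (auto simp: inf_subsets_def E_def)
            have "X - {n} \<in> inf_subsets (M \<inter> beyond (insert n s))"
            proof -
              have "n < x" if "x \<in> X" "x \<noteq> n" for x
                using cInf_lower[of x X] that by (simp add: n_def)
              then show ?thesis using X K by (auto simp: inf_subsets_def E_def beyond_def)
            qed
            then have "P (insert n s \<union> (X - {n}))" using acc by (auto simp: accepts_def)
            moreover have "insert n s \<union> (X - {n}) = s \<union> X" using nX by auto
            ultimately show "P (s \<union> X)" by simp
          qed
          moreover have "E \<subseteq> M" using K by (auto simp: E_def)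
          ultimately show False using True infE unfolding rejects_def by blast
        qed
        then have "infinite (K - E)" using K by simp
        moreover have "D s (K - E)"
          unfolding D_def
        proof (intro impI ballI)
          fix n assume "n \<in> (K - E) \<inter> beyond s"
          then show "rejects P (insert n s) M"
            using dec[of "insert n s"] s True K by (auto simp: E_def)
        qed
        ultimately show ?thesis by blast
      qed
    qed (rule M(2))
    then obtain N where N: "N \<subseteq> M" "infinite N" and DN: "\<And>s. finite s \<Longrightarrow> s \<subseteq> N \<Longrightarrow> D s N"
      by (elim exE conjE) simp
    \<comment> \<open>Hence all finite subsets of \<open>N\<close> are rejected, by induction from the empty set.\<close>
    have rej: "rejects P s M" if "finite s" "s \<subseteq> N" for s
      using that
    proof (induction s rule: finite_linorder_max_induct)
      case empty
      then show ?case using rej0 by simp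
    next
      case (insert n s)
      then have "n \<in> N \<inter> beyond s" "rejects P s M" "D s N" using DN by (auto simp: beyond_def)
      then show ?case using N insert by (auto simp: D_def)
    qed
    have "\<not> P X" if X: "X \<in> inf_subsets N" for X
    proof
      assume "P X"
      have XA: "X \<in> inf_subsets A" using X N M by (auto simp: inf_subsets_def)
      obtain m where m: "\<forall>Y\<in>inf_subsets A. agree m X Y \<longrightarrow> P Y" using op[OF XA \<open>P X\<close>] by blast
      \<comment> \<open>A long enough initial part of \<open>X\<close> is accepted, by openness of \<open>P\<close>.\<close>
      define s where "s = X \<inter> {..m}"
      define K where "K = N - {..m}"
      have "accepts P s K"
        unfolding accepts_def
      proof
        fix Z assume Z: "Z \<in> inf_subsets (K \<inter> beyond s)"
        have "s \<union> Z \<in> inf_subsets A" "agree m X (s \<union> Z)"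
          using Z X N M by (auto simp: inf_subsets_def s_def K_def agree_def)
        then show "P (s \<union> Z)" using m by blast
      qed
      moreover have "K \<subseteq> M" "infinite K" using N by (auto simp: K_def)
      moreover have "rejects P s M" using rej[of s] X by (auto simp: s_def inf_subsets_def)
      ultimately show False unfolding rejects_def by blast
    qed
    then show ?thesis using N M by (intro bexI[of _ N]) (auto simp: inf_subsets_def)
  qed
qed

lemma clopen_on_subset: "clopen_on A P \<Longrightarrow> B \<subseteq> A \<Longrightarrow> clopen_on B P"
  unfolding clopen_on_def using inf_subsets_mono by (meson subsetD)

text \<open>The form used later: one of finitely many clopen sets that cover everything contains all infinite
  subsets of some infinite set.\<close>

lemma clopen_Ramsey:
  fixes P :: "nat \<Rightarrow> nat set \<Rightarrow> bool"
  assumes "infinite A" "\<And>k. k < n \<Longrightarrow> clopen_on A (P k)"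
    and "\<And>X. X \<in> inf_subsets A \<Longrightarrow> \<exists>k<n. P k X"
  shows "\<exists>B\<in>inf_subsets A. \<exists>k<n. \<forall>X\<in>inf_subsets B. P k X"
  using assms
proof (induction n arbitrary: A)
  case 0
  then show ?case by (auto simp: inf_subsets_def)
next
  case (Suc n)
  have "clopen_on A (P n)" using Suc.prems(2) by blast
  then have "\<exists>m. \<forall>Y\<in>inf_subsets A. agree m X Y \<longrightarrow> P n Y"
    if X: "X \<in> inf_subsets A" and PX: "P n X" for X
  proof -
    obtain m where "\<forall>Y\<in>inf_subsets A. agree m X Y \<longrightarrow> P n Y = P n X"
      using bspec[OF \<open>clopen_on A (P n)\<close>[unfolded clopen_on_def] X] ..
    then show ?thesis using PX by (intro exI[of _ m]) simp
  qed
  then obtain B where B: "B \<in> inf_subsets A"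
    and hom: "(\<forall>X\<in>inf_subsets B. P n X) \<or> (\<forall>X\<in>inf_subsets B. \<not> P n X)"
    using open_Ramsey[of A "P n"] Suc.prems(1) by blast
  from hom show ?case
  proof
    assume "\<forall>X\<in>inf_subsets B. P n X"
    then show ?thesis using B by blast
  next
    assume no: "\<forall>X\<in>inf_subsets B. \<not> P n X"
    have BA: "B \<subseteq> A" "infinite B" using B by (auto simp: inf_subsets_def)
    have "\<exists>C\<in>inf_subsets B. \<exists>k<n. \<forall>X\<in>inf_subsets C. P k X"
    proof (rule Suc.IH)
      show "\<exists>k<n. P k X" if "X \<in> inf_subsets B" for X
        using Suc.prems(3)[of X] that no inf_subsets_mono[OF BA(1)] less_Suc_eq by auto
      show "clopen_on B (P k)" if "k < n" for k
        using Suc.prems(2)[of k] that clopen_on_subset[OF _ BA(1)] by simp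
    qed (rule BA(2))
    then show ?thesis using inf_subsets_mono[OF BA(1)] less_SucI by blast
  qed
qed

section \<open>Arrays and better-quasi-orderings\<close>

text \<open>\<open>X\<close> without its least element.  For blocks, the step from \<open>X\<close> to \<open>tail X\<close> corresponds to the relation
  \<open>shift_rel\<close>.\<close>

definition tail :: "nat set \<Rightarrow> nat set" where
  "tail X = X - {Inf X}"

text \<open>An array on \<open>A\<close>: a function \<open>F\<close> on the infinite subsets of \<open>A\<close> with a modulus \<open>m\<close>, such that \<open>F X\<close> and
  \<open>m X\<close> depend only on the elements of \<open>X\<close> up to \<open>m X\<close>.  The initial parts of the sets \<open>X\<close> up to \<open>m X\<close> form
  a block, and \<open>F\<close> corresponds to a function on this block.  The modulus is required to be an
  element of \<open>X\<close>, so that it is the maximum of the initial part.\<close>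

definition array :: "nat set \<Rightarrow> (nat set \<Rightarrow> 'a) \<Rightarrow> (nat set \<Rightarrow> nat) \<Rightarrow> bool" where
  "array A F m \<longleftrightarrow> infinite A \<and> (\<forall>X\<in>inf_subsets A. m X \<in> X \<and>
     (\<forall>Y\<in>inf_subsets A. agree (m X) X Y \<longrightarrow> m Y = m X \<and> F Y = F X))"

text \<open>An array with values in \<open>U\<close> along which \<open>R\<close> fails at each step from \<open>X\<close> to \<open>tail X\<close>.\<close>

definition bad_array ::
    "'a set \<Rightarrow> ('a \<Rightarrow> 'a \<Rightarrow> bool) \<Rightarrow> nat set \<Rightarrow> (nat set \<Rightarrow> 'a) \<Rightarrow> (nat set \<Rightarrow> nat) \<Rightarrow> bool" where
  "bad_array U R A F m \<longleftrightarrow> array A F m \<and>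
     (\<forall>X\<in>inf_subsets A. F X \<in> U \<and> \<not> R (F X) (F (tail X)))"

lemma Inf_in: "infinite X \<Longrightarrow> Inf X \<in> (X :: nat set)"
  by (metis Inf_nat_def1 finite.emptyI)

lemma tail_in: "X \<in> inf_subsets A \<Longrightarrow> tail X \<in> inf_subsets A"
  by (auto simp: inf_subsets_def tail_def)

lemma tail_subset: "tail X \<subseteq> X"
  by (auto simp: tail_def)

lemma agree_mono: "agree m X Y \<Longrightarrow> k \<le> m \<Longrightarrow> agree k X Y"
  unfolding agree_def by (metis atMost_subset_iff inf.absorb2 inf_assoc)

lemma agree_iff: "agree m X Y \<Longrightarrow> x \<le> m \<Longrightarrow> x \<in> X \<longleftrightarrow> x \<in> Y"
  by (auto simp: agree_def)

lemma agree_Inf: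
  assumes "agree m X Y" "n \<in> X" "n \<le> m"
  shows "Inf Y = Inf X"
proof -
  have X: "Inf X \<in> X" "Inf X \<le> m" using assms(2,3) cInf_lower[of n X]
    by (auto intro: Inf_nat_def1)
  then have XY: "Inf X \<in> Y" using agree_iff[OF assms(1)] by blast
  then have Y: "Inf Y \<in> Y" "Inf Y \<le> Inf X" using cInf_lower[of "Inf X" Y]
    by (auto intro: Inf_nat_def1)
  then have "Inf Y \<in> X" using X agree_iff[OF assms(1), of "Inf Y"] by auto
  then have "Inf X \<le> Inf Y" by (auto intro: cInf_lower)
  then show ?thesis using Y by simp
qed

lemma agree_tail:
  assumes "agree m X Y" "n \<in> X" "n \<le> m"
  shows "agree m (tail X) (tail Y)"
  using assms(1) agree_Inf[OF assms] by (auto simp: agree_def tail_def)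

text \<open>The equations in the definition of an array make the simplifier loop, so it is accessed by
  explicit rules only.\<close>

lemma arrayI:
  assumes "infinite A" "\<And>X. X \<in> inf_subsets A \<Longrightarrow> m X \<in> X"
    and "\<And>X Y. \<lbrakk>X \<in> inf_subsets A; Y \<in> inf_subsets A; agree (m X) X Y\<rbrakk> \<Longrightarrow> m Y = m X"
    and "\<And>X Y. \<lbrakk>X \<in> inf_subsets A; Y \<in> inf_subsets A; agree (m X) X Y\<rbrakk> \<Longrightarrow> F Y = F X"
  shows "array A F m"
  unfolding array_def by (intro conjI ballI impI; rule assms)

lemma array_infinite: "array A F m \<Longrightarrow> infinite A"
  unfolding array_def by (rule conjunct1)

lemma array_mod_in:
  assumes "array A F m" "X \<in> inf_subsets A" shows "m X \<in> X"
  by (rule conjunct1[OF bspec[OF conjunct2[OF assms(1)[unfolded array_def]] assms(2)]])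

lemma array_stable:
  assumes "array A F m" "X \<in> inf_subsets A" "Y \<in> inf_subsets A" "agree (m X) X Y"
  shows "m Y = m X" "F Y = F X"
proof -
  have "\<forall>Y\<in>inf_subsets A. agree (m X) X Y \<longrightarrow> m Y = m X \<and> F Y = F X"
    by (rule conjunct2[OF bspec[OF conjunct2[OF assms(1)[unfolded array_def]] assms(2)]])
  from this[rule_format, OF assms(3,4)] show "m Y = m X" "F Y = F X" by simp_all
qed

lemma array_subset:
  assumes "array A F m" "B \<in> inf_subsets A"
  shows "array B F m"
proof -
  have sub: "X \<in> inf_subsets A" if "X \<in> inf_subsets B" for X
    using assms(2) that by (auto simp: inf_subsets_def)
  show ?thesis
  proof (rule arrayI)
    show "infinite B" using assms(2) by (simp add: inf_subsets_def)
    show "m X \<in> X" if "X \<in> inf_subsets B" for X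
      by (rule array_mod_in[OF assms(1) sub[OF that]])
    show "m Y = m X" "F Y = F X"
      if "X \<in> inf_subsets B" "Y \<in> inf_subsets B" "agree (m X) X Y" for X Y
      by (rule array_stable[OF assms(1) sub[OF that(1)] sub[OF that(2)] that(3)])+
  qed
qed

lemma bad_arrayI:
  assumes "array A F m" "\<And>X. X \<in> inf_subsets A \<Longrightarrow> F X \<in> U"
    and "\<And>X. X \<in> inf_subsets A \<Longrightarrow> \<not> R (F X) (F (tail X))"
  shows "bad_array U R A F m"
  unfolding bad_array_def using assms by simp

lemma bad_arrayD:
  assumes "bad_array U R A F m"
  shows "array A F m" "X \<in> inf_subsets A \<Longrightarrow> F X \<in> U"
    "X \<in> inf_subsets A \<Longrightarrow> \<not> R (F X) (F (tail X))"
  using assms unfolding bad_array_def by simp_all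

lemma bad_array_subset:
  assumes "bad_array U R A F m" "B \<in> inf_subsets A"
  shows "bad_array U R B F m"
proof -
  have sub: "X \<in> inf_subsets A" if "X \<in> inf_subsets B" for X
    using assms(2) that by (auto simp: inf_subsets_def)
  show ?thesis
    by (rule bad_arrayI[OF array_subset[OF bad_arrayD(1)[OF assms(1)] assms(2)]])
      (use bad_arrayD(2,3)[OF assms(1)] sub in simp_all)
qed

text \<open>A function of \<open>F X\<close> and \<open>F (tail X)\<close> is again an array, with a modulus that may be taken strictly larger.\<close>

lemma array_modulus_tail:
  fixes F :: "nat set \<Rightarrow> 'a" and G :: "'a \<Rightarrow> 'a \<Rightarrow> 'b"
  assumes "array A F m"
  shows "\<exists>m'. array A (\<lambda>X. G (F X) (F (tail X))) m' \<and> (\<forall>X\<in>inf_subsets A. m X < m' X)"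
proof -
  define m' where "m' X = Inf {n \<in> X. max (m X) (m (tail X)) < n}" for X
  have m': "m' X \<in> X" "m X < m' X" "m (tail X) < m' X" if "X \<in> inf_subsets A" for X
  proof -
    have "infinite X" using that by (auto simp: inf_subsets_def)
    then have "{n \<in> X. max (m X) (m (tail X)) < n} \<noteq> {}"
      using infinite_nat_iff_unbounded[of X] by blast
    then have "m' X \<in> {n \<in> X. max (m X) (m (tail X)) < n}"
      unfolding m'_def by (rule Inf_nat_def1)
    then show "m' X \<in> X" "m X < m' X" "m (tail X) < m' X" by auto
  qed
  have stable: "m' Y = m' X" "G (F Y) (F (tail Y)) = G (F X) (F (tail X))"
    if X: "X \<in> inf_subsets A" and Y: "Y \<in> inf_subsets A" and ag: "agree (m' X) X Y" for X Y
  proof -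
    have 1: "m Y = m X" "F Y = F X"
      using array_stable[OF assms X Y] agree_mono[OF ag] m'(2)[OF X] by auto
    have "agree (m' X) (tail X) (tail Y)" using agree_tail[OF ag m'(1)[OF X]] by simp
    then have 2: "m (tail Y) = m (tail X)" "F (tail Y) = F (tail X)"
      using array_stable[OF assms tail_in[OF X] tail_in[OF Y]] agree_mono m'(3)[OF X]
      by (auto simp: less_imp_le)
    have in_Y: "m' X \<in> Y" using agree_iff[OF ag] m'(1)[OF X] by blast
    have "m' Y \<le> m' X"
      unfolding m'_def[of Y] using in_Y 1 2 m'[OF X] by (intro cInf_lower) auto
    moreover from this have "m' Y \<in> X" using m'(1)[OF Y] agree_iff[OF ag] by blast
    then have "m' X \<le> m' Y"
      unfolding m'_def[of X] using 1 2 m'[OF Y] by (intro cInf_lower) auto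
    ultimately show "m' Y = m' X" by simp
    show "G (F Y) (F (tail Y)) = G (F X) (F (tail X))" using 1 2 by simp
  qed
  have "array A (\<lambda>X. G (F X) (F (tail X))) m'"
    by (rule arrayI[OF array_infinite[OF assms] m'(1) stable])
  then show ?thesis using m'(2) by blast
qed

lemma clopen_on_array:
  fixes F :: "nat set \<Rightarrow> 'a"
  assumes "array A F m"
  shows "clopen_on A (\<lambda>X. P (F X) (F (tail X)))"
proof -
  obtain m' where "array A (\<lambda>X. P (F X) (F (tail X))) m'"
    using array_modulus_tail[OF assms, of P] by blast
  from array_stable(2)[OF this] show ?thesis unfolding clopen_on_def by blast
qed

text \<open>The link to barriers: the minimal initial parts contain, on a smaller domain, a barrier.\<close>

lemma bqo_on_no_bad_array:
  assumes bqo: "bqo_on Q le"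
  shows "\<not> bad_array Q le A F m"
proof
  assume bad: "bad_array Q le A F m"
  then have arr: "array A F m" by (rule bad_arrayD)
  then have infA: "infinite A" by (rule array_infinite)
  define seg where "seg X = X \<inter> {..m X}" for X
  have fin_seg: "finite (seg X)" for X by (simp add: seg_def)
  have seg_stable: "seg Y = seg X"
    if "X \<in> inf_subsets A" "Y \<in> inf_subsets A" "agree (m X) X Y" for X Y
    using array_stable[OF arr that] that(3) by (simp add: seg_def agree_def)
  have seg_Max: "Max (seg X) = m X" "seg X \<noteq> {}" if "X \<in> inf_subsets A" for X
    using array_mod_in[OF arr that] fin_seg[of X] by (auto simp: seg_def intro!: Max_eqI)
  define S where "S = seg ` inf_subsets A"
  \<comment> \<open>A homogeneous set for the initial part being inclusion-minimal.\<close>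
  define C where "C = {s \<in> S. \<forall>t\<in>S. \<not> t \<subset> s}"
  have "\<exists>B\<in>inf_subsets A. (\<forall>X\<in>inf_subsets B. seg X \<in> C) \<or> (\<forall>X\<in>inf_subsets B. seg X \<notin> C)"
  proof (rule open_Ramsey[OF infA])
    fix X assume X: "X \<in> inf_subsets A" "seg X \<in> C"
    have "seg Y \<in> C" if "Y \<in> inf_subsets A" "agree (m X) X Y" for Y
      using seg_stable[OF X(1) that] X(2) by simp
    then show "\<exists>n. \<forall>Y\<in>inf_subsets A. agree n X Y \<longrightarrow> seg Y \<in> C" by auto
  qed
  then obtain B where B: "B \<in> inf_subsets A"
    and hom: "(\<forall>X\<in>inf_subsets B. seg X \<in> C) \<or> (\<forall>X\<in>inf_subsets B. seg X \<notin> C)" by blast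
  have BA: "inf_subsets B \<subseteq> inf_subsets A" using B inf_subsets_mono by (auto simp: inf_subsets_def)
  have infB: "infinite B" and BB: "B \<in> inf_subsets B" using B by (auto simp: inf_subsets_def)
  have extend: "s \<union> (B - {..n}) \<in> inf_subsets B" if "s \<subseteq> B" for s n
    using that infB by (auto simp: inf_subsets_def)
  have seg_extend: "seg (s \<union> (B - {..n})) = seg Y"
    if s: "s \<subseteq> B" and Y: "Y \<in> inf_subsets A" "s \<inter> {..m Y} = seg Y" and n: "m Y \<le> n" for s Y n
  proof (rule seg_stable[OF Y(1)])
    show "s \<union> (B - {..n}) \<in> inf_subsets A" using extend[OF s] BA by blast
    have "(s \<union> (B - {..n})) \<inter> {..m Y} = s \<inter> {..m Y}" using n by auto
    then show "agree (m Y) Y (s \<union> (B - {..n}))" using Y(2) by (simp add: agree_def seg_def)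
  qed
  \<comment> \<open>The negative case is impossible: \<open>seg B\<close> contains a minimal initial part, which continues to a
    subset of \<open>B\<close>.\<close>
  have inC: "seg X \<in> C" if "X \<in> inf_subsets B" for X
  proof -
    have "\<exists>t\<in>S. t \<subseteq> seg B \<and> (\<forall>u\<in>S. \<not> u \<subset> t)"
    proof -
      have "finite {t \<in> S. t \<subseteq> seg B}" using fin_seg[of B] by simp
      moreover have "seg B \<in> {t \<in> S. t \<subseteq> seg B}" using B by (auto simp: S_def)
      ultimately obtain t where t: "t \<in> {t \<in> S. t \<subseteq> seg B}"
        and min: "\<forall>u\<in>{t \<in> S. t \<subseteq> seg B}. u \<subseteq> t \<longrightarrow> t = u"
        using finite_has_minimal2[of "{t \<in> S. t \<subseteq> seg B}" "seg B"] by auto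
      have "\<not> u \<subset> t" if "u \<in> S" for u
        using bspec[OF min, of u] t that by auto
      then show ?thesis using t by (intro bexI[of _ t]) auto
    qed
    then obtain t where t: "t \<in> C" "t \<subseteq> seg B" by (auto simp: C_def)
    then obtain Y where Y: "Y \<in> inf_subsets A" "t = seg Y" by (auto simp: C_def S_def)
    have tB: "t \<subseteq> B" using t(2) by (auto simp: seg_def)
    have "seg (t \<union> (B - {..m Y})) = t"
      using seg_extend[OF tB Y(1), of "m Y"] Y(2) by (simp add: seg_def Int_assoc)
    then have "\<exists>X\<in>inf_subsets B. seg X \<in> C" using extend[OF tB] t(1) by metis
    then show ?thesis using hom that by blast
  qed
  define Bar where "Bar = seg ` inf_subsets B"
  have Bar_sub: "\<Union>Bar \<subseteq> B" by (auto simp: Bar_def seg_def inf_subsets_def)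
  have "barrier Bar"
    unfolding barrier_def block_def
  proof (intro conjI ballI allI impI)
    show "infinite Bar"
    proof
      assume "finite Bar"
      then have "finite (\<Union>Bar)" using fin_seg by (auto simp: Bar_def)
      moreover have "B \<subseteq> \<Union>Bar"
      proof
        fix b assume b: "b \<in> B"
        define X where "X = {b} \<union> (B - {..b})"
        have X: "X \<in> inf_subsets B" unfolding X_def using extend b by blast
        have "m X \<in> X" using array_mod_in[OF arr] X BA by blast
        then have "b \<in> seg X" by (auto simp: seg_def X_def)
        then show "b \<in> \<Union>Bar" using X by (auto simp: Bar_def)
      qed
      ultimately show False using infB finite_subset by blast
    qed
    show "finite b" if "b \<in> Bar" for b using that fin_seg by (auto simp: Bar_def)
    show "\<exists>b\<in>Bar. initial_segment b X" if X: "infinite X \<and> X \<subseteq> \<Union>Bar" for X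
    proof -
      have XB: "X \<in> inf_subsets B" using X Bar_sub by (auto simp: inf_subsets_def)
      then have "initial_segment (seg X) X"
        using fin_seg[of X] seg_Max[of X] BA by (auto simp: initial_segment_def) (auto simp: seg_def)
      then show ?thesis using XB by (auto simp: Bar_def)
    qed
    show "\<not> b \<subseteq> c" if "b \<in> Bar" "c \<in> Bar" "b \<noteq> c" for b c
      using that inC by (auto simp: Bar_def C_def)
  qed
  \<comment> \<open>The array as a function on the barrier.\<close>
  define f where "f s = F (SOME X. X \<in> inf_subsets B \<and> seg X = s)" for s
  have f_seg: "f (seg X) = F X" if X: "X \<in> inf_subsets B" for X
  proof -
    define Y where "Y = (SOME Y. Y \<in> inf_subsets B \<and> seg Y = seg X)"
    have Y: "Y \<in> inf_subsets B \<and> seg Y = seg X" unfolding Y_def by (rule someI[of _ X]) (simp add: X)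
    have XA: "X \<in> inf_subsets A" and YA: "Y \<in> inf_subsets A" using X Y BA by auto
    have "m Y = m X" using seg_Max(1)[OF XA] seg_Max(1)[OF YA] Y by simp
    then have "agree (m X) X Y" using Y by (simp add: seg_def agree_def)
    then have "F Y = F X" by (rule array_stable[OF arr XA YA])
    then show ?thesis by (simp add: f_def Y_def)
  qed
  have "f ` Bar \<subseteq> Q"
    using bad_arrayD(2)[OF bad] f_seg BA by (auto simp: Bar_def)
  with \<open>barrier Bar\<close> obtain b1 b2 where b: "b1 \<in> Bar" "b2 \<in> Bar" "shift_rel b1 b2" "le (f b1) (f b2)"
    using bqo unfolding bqo_on_def by blast
  obtain Y1 Y2 where Y1: "Y1 \<in> inf_subsets B" "b1 = seg Y1" and Y2: "Y2 \<in> inf_subsets B" "b2 = seg Y2"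
    using b by (auto simp: Bar_def)
  obtain i :: "nat \<Rightarrow> nat" and k n where ik: "1 \<le> k" "k < n" and mono: "strict_mono_on {1..n} i"
    and b1: "b1 = i ` {1..k}" and b2: "b2 = i ` {2..n}"
    using b(3) unfolding shift_rel_def by (elim exE conjE)
  have im: "i p \<le> i q \<longleftrightarrow> p \<le> q" if "p \<in> {1..n}" "q \<in> {1..n}" for p q
    using strict_mono_on_leD[OF mono] strict_mono_onD[OF mono] that by (metis leD leI)
  have m1: "m Y1 = i k"
  proof -
    have "Max b1 = i k" unfolding b1 using ik im by (intro Max_eqI) auto
    then show ?thesis using seg_Max Y1 BA by auto
  qed
  have m2: "m Y2 = i n"
  proof -
    have "Max b2 = i n" unfolding b2 using ik im by (intro Max_eqI) auto
    then show ?thesis using seg_Max Y2 BA by auto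
  qed
  \<comment> \<open>An infinite set that begins with \<open>b1\<close> and whose tail begins with \<open>b2\<close>.\<close>
  define s where "s = i ` {1..n}"
  define X where "X = s \<union> (B - {..i n})"
  have "{1..n} = insert 1 {2..n}" using ik by auto
  then have s_insert: "s = insert (i 1) b2" by (simp add: s_def b2)
  moreover have "1 \<in> {1..k}" using ik by auto
  ultimately have s12: "s \<subseteq> b1 \<union> b2" by (auto simp: s_insert b1)
  have sB: "s \<subseteq> B" using s12 Bar_sub b(1,2) by blast
  have X: "X \<in> inf_subsets B" unfolding X_def using extend[OF sB] .
  have "s \<inter> {..i k} = b1" using ik im by (auto simp: s_def b1)
  then have "seg X = b1" unfolding X_def using seg_extend[OF sB, of Y1 "i n"] Y1 BA m1 ik im by auto
  then have F1: "F X = f b1" using f_seg[OF X] by simp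
  have InfX: "Inf X = i 1"
  proof (rule cInf_eq_minimum)
    show "i 1 \<in> X" using ik by (auto simp: X_def s_def)
    show "i 1 \<le> x" if "x \<in> X" for x
    proof (cases "x \<in> s")
      case True
      then obtain p where "p \<in> {1..n}" "x = i p" by (auto simp: s_def)
      then show ?thesis using im[of 1 p] ik by simp
    next
      case False
      then have "i n < x" using that by (simp add: X_def)
      then show ?thesis using im[of 1 n] ik by simp
    qed
  qed
  have "i 1 \<notin> b2"
  proof
    assume "i 1 \<in> b2"
    then obtain p where "p \<in> {2..n}" "i 1 = i p" by (auto simp: b2)
    then show False using im[of p 1] ik by simp
  qed
  then have s2: "s - {i 1} = b2" using s_insert by simp
  have "i 1 \<le> i n" using im ik by auto
  then have "B - {..i n} - {i 1} = B - {..i n}" by auto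
  then have "tail X = b2 \<union> (B - {..i n})"
    using s2 unfolding tail_def InfX by (simp add: X_def Un_Diff)
  moreover have "b2 \<subseteq> B" using Bar_sub b(2) by blast
  moreover have "b2 \<inter> {..i n} = b2"
  proof -
    have "x \<le> i n" if "x \<in> b2" for x
    proof -
      obtain p where "p \<in> {2..n}" "x = i p" using \<open>x \<in> b2\<close> unfolding b2 by blast
      then show ?thesis using im[of p n] ik by simp
    qed
    then show ?thesis by auto
  qed
  ultimately have "seg (tail X) = b2" using seg_extend[of b2 Y2 "i n"] Y2 BA m2 by auto
  then have F2: "F (tail X) = f b2" using f_seg[OF tail_in[OF X]] by simp
  have "X \<in> inf_subsets A" using X BA by blast
  from bad_arrayD(3)[OF bad this] show False using b(4) by (simp add: F1 F2)
qed

section \<open>Minimal bad arrays\<close>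

text \<open>A bad array on \<open>A\<close> and a strictly smaller one on \<open>B \<subseteq> A\<close> are merged: the new domain keeps the elements of
  \<open>A\<close> up to \<open>k\<close>, and the smaller array is used on the subsets of \<open>B\<close>.  The bound \<open>k\<close> on the old modulus
  ensures that the modulus still decides which of the two arrays is used.\<close>

lemma bad_array_merge:
  assumes bad: "bad_array U R A F m" and bad': "bad_array U R B G n" and BA: "B \<subseteq> A"
    and lower: "\<And>X. X \<in> inf_subsets B \<Longrightarrow> m X < n X \<and> (G X, F X) \<in> S"
    and k: "\<And>X. X \<in> inf_subsets B \<Longrightarrow> k \<le> m X"
    and RS: "\<And>a b c. \<lbrakk>a \<in> U; b \<in> U; c \<in> U; R a b; (b, c) \<in> S\<rbrakk> \<Longrightarrow> R a c"
  shows "bad_array U R (B \<union> (A \<inter> {..k})) (\<lambda>X. if X \<subseteq> B then G X else F X)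
     (\<lambda>X. if X \<subseteq> B then n X else m X)"
proof -
  let ?A = "B \<union> (A \<inter> {..k})"
  let ?F = "\<lambda>X. if X \<subseteq> B then G X else F X"
  let ?m = "\<lambda>X. if X \<subseteq> B then n X else m X"
  note arr = bad_arrayD(1)[OF bad] and arr' = bad_arrayD(1)[OF bad']
  have sub: "X \<in> inf_subsets A" if "X \<in> inf_subsets ?A" for X
    using that BA by (auto simp: inf_subsets_def)
  have subB: "X \<in> inf_subsets B" if "X \<in> inf_subsets ?A" "X \<subseteq> B" for X
    using that by (auto simp: inf_subsets_def)
  have same: "X \<subseteq> B \<longleftrightarrow> Y \<subseteq> B"
    if X: "X \<in> inf_subsets ?A" and Y: "Y \<in> inf_subsets ?A" and ag: "agree (?m X) X Y" for X Y
  proof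
    assume XB: "X \<subseteq> B"
    have "k < n X" using k[OF subB[OF X XB]] lower[OF subB[OF X XB]] by simp
    then have "y \<in> X" if "y \<in> Y" "y \<le> k" for y
      using agree_iff[OF ag, of y] that XB by auto
    moreover have "y \<in> B" if "y \<in> Y" "\<not> y \<le> k" for y
      using Y that by (auto simp: inf_subsets_def)
    ultimately show "Y \<subseteq> B" using XB by blast
  next
    assume YB: "Y \<subseteq> B"
    show "X \<subseteq> B"
    proof (rule ccontr)
      assume XB: "\<not> X \<subseteq> B"
      then obtain x where x: "x \<in> X" "x \<notin> B" by blast
      then have "x \<le> k" using X by (auto simp: inf_subsets_def)
      have ag': "agree (m X) X Y" using ag XB by simp
      then have "m Y = m X" by (rule array_stable(1)[OF arr sub[OF X] sub[OF Y]])
      then have "x \<le> m X" using k[OF subB[OF Y YB]] \<open>x \<le> k\<close> by simp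
      then have "x \<in> Y" using agree_iff[OF ag'] x by blast
      then show False using x YB by blast
    qed
  qed
  have stable: "?m Y = ?m X" "?F Y = ?F X"
    if X: "X \<in> inf_subsets ?A" and Y: "Y \<in> inf_subsets ?A" and ag: "agree (?m X) X Y" for X Y
  proof -
    have "?m Y = ?m X \<and> ?F Y = ?F X"
    proof (cases "X \<subseteq> B")
      case True
      then have YB: "Y \<subseteq> B" using same[OF X Y ag] by simp
      have "agree (n X) X Y" using ag True by simp
      from array_stable[OF arr' subB[OF X True] subB[OF Y YB] this] show ?thesis
        using True YB by simp
    next
      case False
      then have YB: "\<not> Y \<subseteq> B" using same[OF X Y ag] by simp
      have "agree (m X) X Y" using ag False by simp
      from array_stable[OF arr sub[OF X] sub[OF Y] this] show ?thesis
        using False YB by simp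
    qed
    then show "?m Y = ?m X" "?F Y = ?F X" by (rule conjunct1, rule conjunct2)
  qed
  have "array ?A ?F ?m"
  proof (rule arrayI[OF _ _ stable])
    show "infinite ?A" using array_infinite[OF arr'] by simp
    show "?m X \<in> X" if "X \<in> inf_subsets ?A" for X
      using array_mod_in[OF arr sub[OF that]] array_mod_in[OF arr' subB[OF that]] by simp
  qed
  then show ?thesis
  proof (rule bad_arrayI)
    fix X assume X: "X \<in> inf_subsets ?A"
    show "?F X \<in> U" using bad_arrayD(2)[OF bad sub[OF X]] bad_arrayD(2)[OF bad' subB[OF X]] by simp
    show "\<not> R (?F X) (?F (tail X))"
    proof (cases "tail X \<subseteq> B")
      case False
      then have "\<not> X \<subseteq> B" using tail_subset[of X] by blast
      then show ?thesis using False bad_arrayD(3)[OF bad sub[OF X]] by simp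
    next
      case True
      note t = subB[OF tail_in[OF X] True]
      show ?thesis
      proof (cases "X \<subseteq> B")
        case True
        then show ?thesis using \<open>tail X \<subseteq> B\<close> bad_arrayD(3)[OF bad' subB[OF X True]] by simp
      next
        case False
        \<comment> \<open>Passing from \<open>F (tail X)\<close> to the smaller value \<open>G (tail X)\<close> keeps the pair bad.\<close>
        have "\<not> R (F X) (G (tail X))"
          using RS[OF bad_arrayD(2)[OF bad sub[OF X]] bad_arrayD(2)[OF bad' t]
              bad_arrayD(2)[OF bad sub[OF tail_in[OF X]]]]
            lower[OF t] bad_arrayD(3)[OF bad sub[OF X]] by blast
        then show ?thesis using True False by simp
      qed
    qed
  qed
qed

text \<open>Minimal bad arrays exist.  Smaller means: on a subset of the domain, all values are smaller in the
  well-founded relation \<open>S\<close>, and all moduli are larger.  The last condition is harmless, since a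
  modulus can always be increased, and it is the reason why the limit in the proof is again an array:
  along each \<open>X\<close> the value changes only together with the modulus.

  If there were no minimal bad array, then one could pass to smaller ones forever.  Each step is
  taken at a place where the modulus to be changed is as small as possible, and the part of the
  domain up to there is kept.  These moduli tend to infinity, so the domains have an infinite
  intersection, on which a limit array exists by well-foundedness.  A bad array below the limit would
  have been a possible choice at all steps, with one fixed modulus.\<close>

theorem minimal_bad_array:
  fixes S :: "('a \<times> 'a) set"
  assumes wf: "wf S" and trans: "trans S"
    and RS: "\<And>a b c. \<lbrakk>a \<in> U; b \<in> U; c \<in> U; R a b; (b, c) \<in> S\<rbrakk> \<Longrightarrow> R a c"
    and ex: "bad_array U R A0 F0 m0"
  shows "\<exists>A F m. bad_array U R A F m \<and> (\<forall>B G n. bad_array U R B G n \<and> B \<subseteq> A \<longrightarrow>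
     (\<exists>X\<in>inf_subsets B. \<not> (m X < n X \<and> (G X, F X) \<in> S)))"
proof (rule ccontr)
  assume no: "\<not> ?thesis"
  \<comment> \<open>An array as one object \<open>t\<close> with domain \<open>dm t\<close>, values \<open>vl t\<close> and moduli \<open>md t\<close>.\<close>
  define bad where "bad t = (case t of (A, F, m) \<Rightarrow> bad_array U R A F m)" for t
  define dm where "dm t = fst t" for t :: "nat set \<times> (nat set \<Rightarrow> 'a) \<times> (nat set \<Rightarrow> nat)"
  define vl where "vl t = fst (snd t)" for t :: "nat set \<times> (nat set \<Rightarrow> 'a) \<times> (nat set \<Rightarrow> nat)"
  define md where "md t = snd (snd t)" for t :: "nat set \<times> (nat set \<Rightarrow> 'a) \<times> (nat set \<Rightarrow> nat)"
  define lt where "lt B t' t \<longleftrightarrow> B \<subseteq> dm t \<and>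
      (\<forall>X\<in>inf_subsets B. md t X < md t' X \<and> (vl t' X, vl t X) \<in> S)" for B t' t
  have bad_iff: "bad t \<longleftrightarrow> bad_array U R (dm t) (vl t) (md t)" for t
    by (simp add: bad_def dm_def vl_def md_def split: prod.split)
  have below: "\<exists>t'. bad t' \<and> lt (dm t') t' t" if "bad t" for t
  proof -
    have "bad_array U R (dm t) (vl t) (md t)" using that bad_iff by simp
    then obtain B G n where "bad_array U R B G n" "B \<subseteq> dm t"
      "\<forall>X\<in>inf_subsets B. md t X < n X \<and> (G X, vl t X) \<in> S"
      using no by (simp only: not_ex de_Morgan_conj not_all not_imp bex_simps not_not) blast
    then show ?thesis
      by (intro exI[of _ "(B, G, n)"]) (simp add: bad_def lt_def dm_def vl_def md_def)
  qed
  \<comment> \<open>The moduli of \<open>t\<close> that some smaller bad array changes.\<close>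
  define cand where "cand t k \<longleftrightarrow> (\<exists>t' X. bad t' \<and> lt (dm t') t' t \<and> X \<in> inf_subsets (dm t') \<and> md t X = k)"
    for t k
  \<comment> \<open>One step from \<open>t\<close> to \<open>t'\<close>: on the subsets of \<open>B\<close> all values decrease, elsewhere nothing changes, and
    \<open>k\<close> is the least modulus that any smaller bad array changes.\<close>
  define step where "step t t' k B \<longleftrightarrow> infinite B \<and> B \<subseteq> dm t' \<and> dm t' \<subseteq> B \<union> {..k} \<and> dm t' \<subseteq> dm t \<and>
      dm t' \<inter> {..k} = dm t \<inter> {..k} \<and> lt B t' t \<and> (\<exists>X\<in>inf_subsets B. md t X = k) \<and>
      (\<forall>X\<in>inf_subsets (dm t'). \<not> X \<subseteq> B \<longrightarrow> md t' X = md t X \<and> vl t' X = vl t X) \<and>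
      (\<forall>j. cand t j \<longrightarrow> k \<le> j)" for t t' k B
  have step_ex: "\<exists>t'. bad t' \<and> (\<exists>k B. step t t' k B)" if t: "bad t" for t
  proof -
    obtain t1 where t1: "bad t1" "lt (dm t1) t1 t" using below[OF t] by blast
    have "infinite (dm t1)" using t1(1) bad_iff bad_arrayD(1) array_infinite by blast
    then have "cand t (md t (dm t1))"
      unfolding cand_def using t1 by (intro exI[of _ t1] exI[of _ "dm t1"]) (simp add: inf_subsets_def)
    then have "cand t (LEAST k. cand t k)" by (rule LeastI)
    then obtain t2 X where t2: "bad t2" "lt (dm t2) t2 t" and X: "X \<in> inf_subsets (dm t2)"
      and Xk: "md t X = (LEAST k. cand t k)" unfolding cand_def by blast
    define k where "k = (LEAST k. cand t k)"
    have least: "k \<le> j" if "cand t j" for j unfolding k_def using that by (rule Least_le)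
    have k_le: "k \<le> md t X" if "X \<in> inf_subsets (dm t2)" for X
      using least[of "md t X"] t2 that unfolding cand_def by blast
    define t' where "t' = (dm t2 \<union> (dm t \<inter> {..k}), \<lambda>X. if X \<subseteq> dm t2 then vl t2 X else vl t X,
      \<lambda>X. if X \<subseteq> dm t2 then md t2 X else md t X)"
    have t': "dm t' = dm t2 \<union> (dm t \<inter> {..k})" "vl t' X = (if X \<subseteq> dm t2 then vl t2 X else vl t X)"
      "md t' X = (if X \<subseteq> dm t2 then md t2 X else md t X)" for X
      by (simp_all add: t'_def dm_def vl_def md_def)
    have "bad t'"
      unfolding t'_def bad_def prod.case
    proof (rule bad_array_merge)
      show "bad_array U R (dm t) (vl t) (md t)" using t bad_iff by simp
      show "bad_array U R (dm t2) (vl t2) (md t2)" using t2(1) bad_iff by simp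
      show "dm t2 \<subseteq> dm t" using t2(2) by (simp add: lt_def)
      show "md t X < md t2 X \<and> (vl t2 X, vl t X) \<in> S" if "X \<in> inf_subsets (dm t2)" for X
        using t2(2) that by (simp add: lt_def)
      show "k \<le> md t X" if "X \<in> inf_subsets (dm t2)" for X by (rule k_le[OF that])
      show "R a c" if "a \<in> U" "b \<in> U" "c \<in> U" "R a b" "(b, c) \<in> S" for a b c
        by (rule RS[OF that])
    qed
    moreover have "step t t' k (dm t2)"
      unfolding step_def
    proof (intro conjI)
      show "infinite (dm t2)" using X finite_subset by (auto simp: inf_subsets_def)
      show "\<exists>X\<in>inf_subsets (dm t2). md t X = k" using X Xk k_def by blast
      show "lt (dm t2) t' t" using t2(2) t' by (auto simp: lt_def inf_subsets_def)
      show "\<forall>X\<in>inf_subsets (dm t'). \<not> X \<subseteq> dm t2 \<longrightarrow> md t' X = md t X \<and> vl t' X = vl t X"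
        using t' by simp
    qed (use t' least t2(2) in \<open>auto simp: lt_def\<close>)
    ultimately show ?thesis by blast
  qed
  have "\<exists>f. \<forall>i::nat. bad (f i) \<and> (\<exists>k B. step (f i) (f (Suc i)) k B)"
  proof (rule dependent_nat_choice)
    show "\<exists>t. bad t" using ex by (intro exI[of _ "(A0, F0, m0)"]) (simp add: bad_def)
  qed (use step_ex in blast)
  then obtain t where t_ex: "\<forall>i::nat. bad (t i) \<and> (\<exists>k B. step (t i) (t (Suc i)) k B)" ..
  have bad_t: "bad (t i)" for i using t_ex by simp
  have ex_t: "\<forall>i. \<exists>k B. step (t i) (t (Suc i)) k B" using t_ex by simp
  from choice[OF ex_t] obtain k where "\<forall>i. \<exists>B. step (t i) (t (Suc i)) (k i) B" ..
  from choice[OF this] obtain B where st: "\<And>i. step (t i) (t (Suc i)) (k i) (B i)" by blast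
  have bad_ti: "bad_array U R (dm (t i)) (vl (t i)) (md (t i))" for i using bad_t bad_iff by blast
  note arr = bad_arrayD(1)[OF bad_ti]
  have dm_anti: "dm (t j) \<subseteq> dm (t i)" if "i \<le> j" for i j
    by (rule lift_Suc_antimono_le[OF _ that]) (use st in \<open>simp add: step_def\<close>)
  have sub: "X \<in> inf_subsets (dm (t i))" if "X \<in> inf_subsets (dm (t j))" "i \<le> j" for X i j
    using that dm_anti[of i j] by (auto simp: inf_subsets_def)
  define same where "same i j X \<longleftrightarrow> md (t j) X = md (t i) X \<and> vl (t j) X = vl (t i) X" for i j X
  define less where "less i j X \<longleftrightarrow> md (t i) X < md (t j) X \<and> (vl (t j) X, vl (t i) X) \<in> S" for i j X
  have less_B: "less i (Suc i) X" if "X \<in> inf_subsets (B i)" for i X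
    using st[of i] that by (auto simp: step_def lt_def less_def)
  have same_B: "same i (Suc i) X" if "X \<in> inf_subsets (dm (t (Suc i)))" "\<not> X \<subseteq> B i" for i X
    using st[of i] that by (auto simp: step_def same_def)
  have trend: "same i j X \<or> less i j X" if "X \<in> inf_subsets (dm (t j))" "i \<le> j" for X i j
    using that(2,1)
  proof (induction j rule: dec_induct)
    case base
    then show ?case by (simp add: same_def)
  next
    case (step j)
    have IH: "same i j X \<or> less i j X" using step.IH sub[OF step.prems] by simp
    have "same j (Suc j) X \<or> less j (Suc j) X"
    proof (cases "X \<subseteq> B j")
      case True
      then show ?thesis using less_B step.prems by (auto simp: inf_subsets_def)
    qed (use same_B step.prems in simp)
    with IH show ?case unfolding same_def less_def using transD[OF trans] by auto
  qed
  have md_mono: "md (t i) X \<le> md (t j) X" if "X \<in> inf_subsets (dm (t j))" "i \<le> j" for X i j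
    using trend[OF that] by (auto simp: same_def less_def)
  have BD: "B i \<subseteq> dm (t (Suc i))" "infinite (B i)" for i using st[of i] by (auto simp: step_def)
  have BinfD: "X \<in> inf_subsets (dm (t (Suc i)))" if "X \<in> inf_subsets (B i)" for X i
    using that BD by (auto simp: inf_subsets_def)
  have k_least: "k i \<le> md (t i) X"
    if "bad t'" "lt (dm t') t' (t i)" "X \<in> inf_subsets (dm t')" for i t' X
    using st[of i] that unfolding step_def cand_def by blast
  have k_Suc: "k i \<le> k (Suc i)" for i
  proof -
    define t' where "t' = (B (Suc i), vl (t (Suc (Suc i))), md (t (Suc (Suc i))))"
    have t': "dm t' = B (Suc i)" "vl t' = vl (t (Suc (Suc i)))" "md t' = md (t (Suc (Suc i)))"
      by (simp_all add: t'_def dm_def vl_def md_def)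
    have "B (Suc i) \<in> inf_subsets (dm (t (Suc (Suc i))))" using BD by (simp add: inf_subsets_def)
    then have "bad t'"
      unfolding t'_def bad_def prod.case by (rule bad_array_subset[OF bad_ti])
    moreover have "lt (dm t') t' (t i)"
      unfolding lt_def
    proof (intro conjI ballI)
      show "dm t' \<subseteq> dm (t i)" using t'(1) BD(1)[of "Suc i"] dm_anti[of i "Suc (Suc i)"] by auto
      fix X assume "X \<in> inf_subsets (dm t')"
      then have X: "X \<in> inf_subsets (B (Suc i))" using t' by simp
      have "same i (Suc i) X \<or> less i (Suc i) X"
        using trend[of X "Suc i" i] sub[OF BinfD[OF X], of "Suc i"] by simp
      then show "md (t i) X < md t' X" "(vl t' X, vl (t i) X) \<in> S"
        using less_B[OF X] transD[OF trans] unfolding same_def less_def t' by auto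
    qed
    moreover obtain X where X: "X \<in> inf_subsets (B (Suc i))" "md (t (Suc i)) X = k (Suc i)"
      using st[of "Suc i"] by (auto simp: step_def)
    ultimately have "k i \<le> md (t i) X" using k_least[of t' i X] t' by simp
    also have "\<dots> \<le> k (Suc i)" using md_mono[of X "Suc i" i] X sub[OF BinfD[OF X(1)], of "Suc i"] by simp
    finally show ?thesis .
  qed
  have k_mono: "k i \<le> k j" if "i \<le> j" for i j using lift_Suc_mono_le[of k i j] k_Suc that by simp
  \<comment> \<open>Otherwise two steps would change the array at the same initial part with the same modulus,
    although the first of them has increased the modulus there.\<close>
  have unbounded: "\<exists>i. n < k i" for n
  proof (rule ccontr)
    assume "\<not> ?thesis"
    then have le_n: "k i \<le> n" for i by (simp add: not_less)
    have "\<exists>X. X \<in> inf_subsets (B i) \<and> md (t i) X = k i" for i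
      using st[of i] by (auto simp: step_def)
    then have "\<forall>i. \<exists>X. X \<in> inf_subsets (B i) \<and> md (t i) X = k i" by blast
    from choice[OF this] obtain X where X: "\<And>i. X i \<in> inf_subsets (B i)" "\<And>i. md (t i) (X i) = k i"
      by blast
    let ?h = "\<lambda>i. (k i, X i \<inter> {..k i})"
    have "range ?h \<subseteq> {..n} \<times> Pow {..n}" using le_n by (auto intro: order_trans)
    then have "finite (range ?h)" by (rule finite_subset) simp
    then have "\<not> inj ?h" using finite_imageD by blast
    then obtain i j where "i \<noteq> j" "?h i = ?h j" by (auto simp: inj_def)
    then obtain i j where ij: "i < j" "k i = k j" "X i \<inter> {..k i} = X j \<inter> {..k j}"
      by (cases i j rule: linorder_cases) auto
    have Xj: "X j \<in> inf_subsets (dm (t (Suc j)))" by (rule BinfD[OF X(1)])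
    have XjSi: "X j \<in> inf_subsets (dm (t (Suc i)))" using sub[OF Xj, of "Suc i"] ij by simp
    have Xji: "X j \<in> inf_subsets (dm (t i))" and Xii: "X i \<in> inf_subsets (dm (t i))"
      using sub[OF Xj, of i] sub[OF BinfD[OF X(1)[of i]], of i] ij by auto
    have "agree (md (t i) (X i)) (X i) (X j)" using ij X(2) by (simp add: agree_def)
    then have "md (t i) (X j) = k i" using array_stable(1)[OF arr Xii Xji] X(2) by simp
    have "X j \<subseteq> B i"
    proof
      fix x assume x: "x \<in> X j"
      show "x \<in> B i"
      proof (cases "x \<le> k i")
        case True
        then have "x \<in> X i" using ij x by auto
        then show ?thesis using X(1)[of i] by (auto simp: inf_subsets_def)
      next
        case False
        moreover have "x \<in> dm (t (Suc i))" using x XjSi by (auto simp: inf_subsets_def)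
        ultimately show ?thesis using st[of i] by (auto simp: step_def)
      qed
    qed
    then have "X j \<in> inf_subsets (B i)" using XjSi by (auto simp: inf_subsets_def)
    then have "md (t i) (X j) < md (t (Suc i)) (X j)" using less_B by (auto simp: less_def)
    also have "\<dots> \<le> md (t j) (X j)" using md_mono[of "X j" j "Suc i"] sub[OF Xj, of j] ij by simp
    finally show False using X(2)[of j] ij \<open>md (t i) (X j) = k i\<close> by simp
  qed
  define A where "A = (\<Inter>i. dm (t i))"
  have "k i \<in> A" for i
  proof -
    obtain X where X: "X \<in> inf_subsets (B i)" "md (t i) X = k i"
      using st[of i] by (auto simp: step_def)
    have "k i \<in> X" using array_mod_in[OF arr[of i], of X] sub[OF BinfD[OF X(1)], of i] X(2) by simp
    then have Si: "k i \<in> dm (t (Suc i))" using BinfD[OF X(1)] by (auto simp: inf_subsets_def)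
    have later: "k i \<in> dm (t j)" if "Suc i \<le> j" for j
      using that
    proof (induction j rule: dec_induct)
      case base
      then show ?case by (rule Si)
    next
      case (step j)
      have "dm (t (Suc j)) \<inter> {..k j} = dm (t j) \<inter> {..k j}" using st[of j] by (simp add: step_def)
      moreover have "k i \<le> k j" using k_mono step.hyps by simp
      ultimately show ?case using step.IH by auto
    qed
    have "k i \<in> dm (t j)" for j
      using later[of j] Si dm_anti[of j "Suc i"] by (cases "Suc i \<le> j") auto
    then show ?thesis by (simp add: A_def)
  qed
  then have "range k \<subseteq> A" by blast
  moreover have "infinite (range k)"
    unfolding infinite_nat_iff_unbounded using unbounded by blast
  ultimately have infA: "infinite A" using finite_subset by blast
  have At: "X \<in> inf_subsets (dm (t i))" if "X \<in> inf_subsets A" for X i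
    using that by (auto simp: A_def inf_subsets_def)
  have ev: "\<exists>i. \<forall>j\<ge>i. same i j X" if X: "X \<in> inf_subsets A" for X
  proof -
    have "vl (t 0) X \<in> range (\<lambda>i. vl (t i) X)" by auto
    from mp[OF spec[OF spec[OF wf[unfolded wf_eq_minimal]]] this]
    obtain v where "v \<in> range (\<lambda>i. vl (t i) X)"
      and min: "\<forall>u. (u, v) \<in> S \<longrightarrow> u \<notin> range (\<lambda>i. vl (t i) X)" ..
    then obtain i where i: "v = vl (t i) X" by blast
    have "same i j X" if "i \<le> j" for j
      using trend[OF At[OF X] that] spec[OF min, of "vl (t j) X"] unfolding less_def i by blast
    then show ?thesis by blast
  qed
  \<comment> \<open>A stage from which on nothing changes at \<open>X\<close>.\<close>
  define l where "l X = (SOME i. \<forall>j\<ge>i. same i j X)" for X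
  have l: "same (l X) j X" if "X \<in> inf_subsets A" "l X \<le> j" for X j
    using someI_ex[OF ev[OF that(1)]] that(2) by (simp add: l_def)
  define F where "F X = vl (t (l X)) X" for X
  define m where "m X = md (t (l X)) X" for X
  have lim: "F X = vl (t j) X" "m X = md (t j) X" if "X \<in> inf_subsets A" "l X \<le> j" for X j
    using l[OF that] by (auto simp: F_def m_def same_def)
  have "array A F m"
  proof (rule arrayI[OF infA])
    show "m X \<in> X" if "X \<in> inf_subsets A" for X
      unfolding m_def using array_mod_in[OF arr At[OF that]] .
    fix X Y assume X: "X \<in> inf_subsets A" and Y: "Y \<in> inf_subsets A" and ag: "agree (m X) X Y"
    define j where "j = max (l X) (l Y)"
    have j: "l X \<le> j" "l Y \<le> j" by (simp_all add: j_def)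
    have "agree (md (t j) X) X Y" using ag lim(2)[OF X j(1)] by simp
    from array_stable[OF arr At[OF X] At[OF Y] this]
    show "m Y = m X" "F Y = F X" using lim[OF X j(1)] lim[OF Y j(2)] by simp_all
  qed
  then have badA: "bad (A, F, m)"
    unfolding bad_def prod.case
  proof (rule bad_arrayI)
    fix X assume X: "X \<in> inf_subsets A"
    show "F X \<in> U" unfolding F_def by (rule bad_arrayD(2)[OF bad_ti At[OF X]])
    define j where "j = max (l X) (l (tail X))"
    have j: "l X \<le> j" "l (tail X) \<le> j" by (simp_all add: j_def)
    show "\<not> R (F X) (F (tail X))"
      using bad_arrayD(3)[OF bad_ti At[OF X], of j] lim(1)[OF X j(1)] lim(1)[OF tail_in[OF X] j(2)]
      by simp
  qed
  \<comment> \<open>A bad array \<open>t'\<close> below the limit is below all stages, which bounds \<open>k\<close>.\<close>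
  obtain t' where t': "bad t'" "lt (dm t') t' (A, F, m)" using below[OF badA] by blast
  define X where "X = dm t'"
  have "infinite X" unfolding X_def using t'(1) bad_iff bad_arrayD(1) array_infinite by blast
  then have XX: "X \<in> inf_subsets (dm t')" by (simp add: X_def inf_subsets_def)
  have lt': "dm t' \<subseteq> A" "\<And>Y. Y \<in> inf_subsets (dm t') \<Longrightarrow> m Y < md t' Y \<and> (vl t' Y, F Y) \<in> S"
    using t'(2) by (auto simp: lt_def dm_def vl_def md_def)
  have YA: "Y \<in> inf_subsets A" if "Y \<in> inf_subsets (dm t')" for Y
    using that lt'(1) by (auto simp: inf_subsets_def)
  have up: "md (t i) Y \<le> m Y \<and> (F Y = vl (t i) Y \<or> (F Y, vl (t i) Y) \<in> S)"
    if Y: "Y \<in> inf_subsets A" for Y i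
    using trend[OF At[OF Y], of i "max i (l Y)"] lim[OF Y, of "max i (l Y)"]
    by (auto simp: same_def less_def)
  have bound: "k i \<le> m X" for i
  proof -
    have "lt (dm t') t' (t i)"
      unfolding lt_def
    proof (intro conjI ballI)
      show "dm t' \<subseteq> dm (t i)" using lt'(1) by (auto simp: A_def)
      fix Y assume Y: "Y \<in> inf_subsets (dm t')"
      show "md (t i) Y < md t' Y" using up[OF YA[OF Y], of i] lt'(2)[OF Y] by simp
      show "(vl t' Y, vl (t i) Y) \<in> S" using up[OF YA[OF Y], of i] lt'(2)[OF Y] transD[OF trans] by auto
    qed
    then have "k i \<le> md (t i) X" using k_least[OF t'(1) _ XX] by blast
    then show ?thesis using up[OF YA[OF XX], of i] by simp
  qed
  obtain i where "m X < k i" using unbounded by blast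
  then show False using bound[of i] by simp
qed

section \<open>Gluing embeddings of labelled sets of reals\<close>

text \<open>\<open>h\<close> is strictly increasing and continuous on \<open>V\<close>, maps \<open>V\<close> to \<open>W\<close> and increases labels.  Continuity is
  expressed by limits within \<open>V\<close> instead of sequences.  The sets \<open>V\<close> and \<open>W\<close> will be parts of the domains
  of \<open>A\<close> and \<open>B\<close>.\<close>

definition label_embedding ::
    "('a \<Rightarrow> 'a \<Rightarrow> bool) \<Rightarrow> (real \<rightharpoonup> 'a) \<Rightarrow> real set \<Rightarrow> (real \<rightharpoonup> 'a) \<Rightarrow> real set \<Rightarrow> (real \<Rightarrow> real) \<Rightarrow> bool" where
  "label_embedding le A V B W h \<longleftrightarrow> strict_mono_on V h \<and>
     (\<forall>x\<in>V. h x \<in> W \<and> le (the (A x)) (the (B (h x))) \<and> (h \<longlongrightarrow> h x) (at x within V))"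

lemma label_embeddingI:
  assumes "\<And>x y. \<lbrakk>x \<in> V; y \<in> V; x < y\<rbrakk> \<Longrightarrow> h x < h y"
    and "\<And>x. x \<in> V \<Longrightarrow> h x \<in> W"
    and "\<And>x. x \<in> V \<Longrightarrow> le (the (A x)) (the (B (h x)))"
    and "\<And>x. x \<in> V \<Longrightarrow> (h \<longlongrightarrow> h x) (at x within V)"
  shows "label_embedding le A V B W h"
  using assms by (auto simp: label_embedding_def strict_mono_on_def)

lemma label_embeddingD:
  assumes "label_embedding le A V B W h" "x \<in> V"
  shows "h x \<in> W" "le (the (A x)) (the (B (h x)))" "(h \<longlongrightarrow> h x) (at x within V)"
    "y \<in> V \<Longrightarrow> x < y \<Longrightarrow> h x < h y"
  using assms by (auto simp: label_embedding_def strict_mono_on_def)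

lemma tendsto_compose_within:
  fixes f g :: "real \<Rightarrow> real"
  assumes "(f \<longlongrightarrow> f x) (at x within V)" "(g \<longlongrightarrow> g (f x)) (at (f x) within f ` V)"
  shows "((\<lambda>x. g (f x)) \<longlongrightarrow> g (f x)) (at x within V)"
  using continuous_within_compose[of x V f g] assms by (simp add: continuous_within o_def)

lemma smc_embeddable_iff:
  "smc_embeddable le A B \<longleftrightarrow> (\<exists>h. label_embedding le A (dom A) B (dom B) h)"
proof -
  have "(\<forall>(p :: nat \<Rightarrow> real) x. (\<forall>n. p n \<in> V) \<and> x \<in> V \<and> p \<longlonglongrightarrow> x \<longrightarrow> (\<lambda>n. h (p n)) \<longlonglongrightarrow> h x) \<longleftrightarrow>
      (\<forall>x\<in>V. (h \<longlongrightarrow> h x) (at x within V))" for V and h :: "real \<Rightarrow> real"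
    using continuous_within_sequentially[of _ V h] by (auto simp: continuous_within o_def)
  then show ?thesis
    unfolding smc_embeddable_def smc_embedding_def label_embedding_def
    by (intro arg_cong[where f = Ex] ext) (simp only: image_subset_iff ball_conj_distrib, blast)
qed

lemma label_embedding_cong:
  assumes "label_embedding le A V B W h" "\<And>x. x \<in> V \<Longrightarrow> A x = A' x" "\<And>y. y \<in> W \<Longrightarrow> B y = B' y"
  shows "label_embedding le A' V B' W h"
  using assms by (auto simp: label_embedding_def)

lemma smc_embeddable_restrict_iff:
  "smc_embeddable le (A |` S) (B |` T) \<longleftrightarrow>
     (\<exists>h. label_embedding le A (dom A \<inter> S) B (dom B \<inter> T) h)"
proof -
  have "label_embedding le (A |` S) (dom A \<inter> S) (B |` T) (dom B \<inter> T) h \<longleftrightarrow>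
      label_embedding le A (dom A \<inter> S) B (dom B \<inter> T) h" for h
    by (auto intro: label_embedding_cong)
  then show ?thesis by (simp add: smc_embeddable_iff)
qed

lemma smc_embeddable_mono:
  assumes "reflp_on Q le" "ran A \<subseteq> Q" "S \<subseteq> T"
  shows "smc_embeddable le (A |` S) (A |` T)"
proof -
  have "le (the (A x)) (the (A x))" if "x \<in> dom A" for x
    using that assms(1,2) by (auto simp: reflp_on_def ran_def)
  then have "label_embedding le A (dom A \<inter> S) A (dom A \<inter> T) (\<lambda>x. x)"
    using assms(3) by (intro label_embeddingI) (auto intro: tendsto_ident_at)
  then show ?thesis unfolding smc_embeddable_restrict_iff by blast
qed

lemma smc_embeddable_refl:
  assumes "reflp_on Q le" "ran A \<subseteq> Q" shows "smc_embeddable le A A"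
  using smc_embeddable_mono[OF assms, of UNIV UNIV] by (simp add: restrict_map_def)

lemma smc_embeddable_trans:
  assumes "transp_on Q le" "ran A \<subseteq> Q" "ran B \<subseteq> Q" "ran C \<subseteq> Q"
    and "smc_embeddable le A B" "smc_embeddable le B C"
  shows "smc_embeddable le A C"
proof -
  obtain f g where f: "label_embedding le A (dom A) B (dom B) f"
    and g: "label_embedding le B (dom B) C (dom C) g"
    using assms(5,6) unfolding smc_embeddable_iff by blast
  have inQ: "the (M x) \<in> Q" if "x \<in> dom M" "ran M \<subseteq> Q" for M :: "real \<rightharpoonup> 'a" and x
    using that by (auto simp: ran_def)
  have "label_embedding le A (dom A) C (dom C) (\<lambda>x. g (f x))"
  proof (rule label_embeddingI)
    fix x assume x: "x \<in> dom A"
    note fx = label_embeddingD[OF f x]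
    note gx = label_embeddingD[OF g fx(1)]
    show "g (f x) \<in> dom C" by (rule gx(1))
    show "le (the (A x)) (the (C (g (f x))))"
      by (rule transp_onD[OF assms(1) _ _ _ fx(2) gx(2)])
        (use inQ x fx(1) gx(1) assms(2-4) in blast)+
    have "(g \<longlongrightarrow> g (f x)) (at (f x) within f ` dom A)"
      using gx(3) by (rule tendsto_within_subset) (use label_embeddingD(1)[OF f] in auto)
    with fx(3) show "((\<lambda>x. g (f x)) \<longlongrightarrow> g (f x)) (at x within dom A)"
      by (rule tendsto_compose_within)
    show "g (f x) < g (f y)" if "y \<in> dom A" "x < y" for y
      by (rule gx(4)[OF label_embeddingD(1)[OF f that(1)] fx(4)[OF that]])
  qed
  then show ?thesis unfolding smc_embeddable_iff by blast
qed

lemma smc_embeddable_empty: "dom A = {} \<Longrightarrow> smc_embeddable le A B"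
  unfolding smc_embeddable_iff by (auto intro!: exI label_embeddingI)

lemma tendsto_within_local:
  fixes h g :: "real \<Rightarrow> real"
  assumes "(g \<longlongrightarrow> g x) (at x within V)" "open S" "x \<in> S" "V' \<inter> S \<subseteq> V" "x \<in> V'"
    and eq: "\<And>y. y \<in> V' \<inter> S \<Longrightarrow> h y = g y"
  shows "(h \<longlongrightarrow> h x) (at x within V')"
proof -
  have "(g \<longlongrightarrow> g x) (at x within (V' \<inter> S))" using assms(1,4) by (rule tendsto_within_subset)
  then have "(h \<longlongrightarrow> h x) (at x within (V' \<inter> S))"
    using eq assms(3,5) by (subst Lim_cong_within[where g = g and y = "g x"]) auto
  then show ?thesis using at_within_nhd[OF assms(3,2), of "V' \<inter> S" V'] by simp
qed

text \<open>Gluing at a pair of cuts; continuity cannot fail at \<open>c\<close>, since \<open>c \<notin> V\<close>.\<close>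

lemma label_embedding_glue_cut:
  assumes f: "label_embedding le A (V \<inter> {..<c}) B (W \<inter> {..<d}) f"
    and g: "label_embedding le A (V \<inter> {c<..}) B (W \<inter> {d<..}) g"
    and c: "c \<notin> V"
  shows "label_embedding le A V B W (\<lambda>x. if x < c then f x else g x)" (is "label_embedding _ _ _ _ _ ?h")
proof (rule label_embeddingI)
  fix x assume x: "x \<in> V"
  then consider "x \<in> V \<inter> {..<c}" | "x \<in> V \<inter> {c<..}" using c by (cases x c rule: linorder_cases) auto
  note cs = this
  show "?h x \<in> W"
    using cs label_embeddingD(1)[OF f, of x] label_embeddingD(1)[OF g, of x] by cases auto
  show "le (the (A x)) (the (B (?h x)))"
    using cs label_embeddingD(2)[OF f, of x] label_embeddingD(2)[OF g, of x] by cases auto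
  show "(?h \<longlongrightarrow> ?h x) (at x within V)"
    using cs
  proof cases
    case 1
    show ?thesis
      by (rule tendsto_within_local[OF label_embeddingD(3)[OF f 1], of "{..<c}"]) (use 1 in auto)
  next
    case 2
    show ?thesis
      by (rule tendsto_within_local[OF label_embeddingD(3)[OF g 2], of "{c<..}"]) (use 2 in auto)
  qed
  fix y assume y: "y \<in> V" "x < y"
  show "?h x < ?h y"
    using cs
  proof cases
    case 1
    show ?thesis
    proof (cases "y < c")
      case True
      then show ?thesis using label_embeddingD(4)[OF f 1, of y] 1 y by auto
    next
      case False
      then have "y \<in> V \<inter> {c<..}" using y c by (cases y c rule: linorder_cases) auto
      then show ?thesis using label_embeddingD(1)[OF f 1] label_embeddingD(1)[OF g, of y] 1 by auto
    qed
  next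
    case 2
    then show ?thesis using label_embeddingD(4)[OF g 2, of y] y by auto
  qed
qed

text \<open>Gluing at a point \<open>x\<close> that both embeddings send to \<open>y\<close>.\<close>

lemma label_embedding_glue_point:
  assumes f: "label_embedding le A (V \<inter> {..x}) B (W \<inter> {..y}) f"
    and g: "label_embedding le A (V \<inter> {x..}) B (W \<inter> {y..}) g"
    and x: "x \<in> V" and fg: "f x = y" "g x = y"
  shows "label_embedding le A V B W (\<lambda>z. if z \<le> x then f z else g z)" (is "label_embedding _ _ _ _ _ ?h")
proof (rule label_embeddingI)
  have hg: "?h z = g z" if "x \<le> z" for z using fg that by auto
  fix u assume u: "u \<in> V"
  consider "u < x" "u \<in> V \<inter> {..x}" | "u = x" "u \<in> V \<inter> {..x}" | "x < u" "u \<in> V \<inter> {x..}"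
    using u by (cases u x rule: linorder_cases) auto
  note cs = this
  show "?h u \<in> W"
    using cs label_embeddingD(1)[OF f, of u] label_embeddingD(1)[OF g, of u] by cases auto
  show "le (the (A u)) (the (B (?h u)))"
    using cs label_embeddingD(2)[OF f, of u] label_embeddingD(2)[OF g, of u] by cases auto
  show "(?h \<longlongrightarrow> ?h u) (at u within V)"
    using cs
  proof cases
    case 1
    show ?thesis
      by (rule tendsto_within_local[OF label_embeddingD(3)[OF f 1(2)], of "{..<x}"]) (use 1 in auto)
  next
    case 3
    show ?thesis
      by (rule tendsto_within_local[OF label_embeddingD(3)[OF g 3(2)], of "{x<..}"]) (use 3 in auto)
  next
    case 2
    have "(?h \<longlongrightarrow> y) (at x within V \<inter> {..x})"
      using label_embeddingD(3)[OF f, of x] x fg(1)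
      by (subst Lim_cong_within[where g = f and y = y]) auto
    moreover have "(?h \<longlongrightarrow> y) (at x within V \<inter> {x..})"
      using label_embeddingD(3)[OF g, of x] x fg(2) hg
      by (subst Lim_cong_within[where g = g and y = y]) auto
    ultimately have "(?h \<longlongrightarrow> y) (at x within (V \<inter> {..x}) \<union> (V \<inter> {x..}))" by (rule Lim_Un)
    moreover have "(V \<inter> {..x}) \<union> (V \<inter> {x..}) = V" by auto
    ultimately show ?thesis using 2 fg by simp
  qed
  fix v assume v: "v \<in> V" "u < v"
  show "?h u < ?h v"
  proof (cases "v \<le> x")
    case True
    then show ?thesis using label_embeddingD(4)[OF f, of u v] u v by auto
  next
    case False
    show ?thesis
    proof (cases "x \<le> u")
      case True
      then show ?thesis using hg label_embeddingD(4)[OF g, of u v] u v by auto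
    next
      case False
      then have "f u < f x" using label_embeddingD(4)[OF f, of u x] u x by auto
      also have "\<dots> < g v" using label_embeddingD(4)[OF g, of x v] fg x v \<open>\<not> v \<le> x\<close> by auto
      finally show ?thesis using False \<open>\<not> v \<le> x\<close> by auto
    qed
  qed
qed

text \<open>Gluing infinitely many embeddings of pieces that increase to a point.  The pieces are sent to pieces
  that increase to \<open>y\<close>, so the result is continuous at \<open>x\<close>.  No assumption is made on the
  pieces being nonempty; so \<open>x\<close> need not be a limit of \<open>V\<close>.\<close>
lemma label_embedding_left_limit:
  fixes c d :: "nat \<Rightarrow> real"
  assumes c: "incseq c" "c \<longlonglongrightarrow> x" "\<And>i. c i \<notin> V"
    and d: "incseq d" "d \<longlonglongrightarrow> y" "\<And>i. d i < y"
    and x: "x \<in> V" and y: "y \<in> W" and xy: "le (the (A x)) (the (B y))"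
    and pieces: "\<And>i n. \<exists>j\<ge>n. \<exists>h. label_embedding le A (V \<inter> {c i<..<c (Suc i)}) B (W \<inter> {d j<..<d (Suc j)}) h"
  shows "\<exists>h. label_embedding le A (V \<inter> {c 0<..x}) B (W \<inter> {d 0<..y}) h \<and> h x = y"
proof -
  define E where "E i j \<longleftrightarrow> (\<exists>h. label_embedding le A (V \<inter> {c i<..<c (Suc i)}) B (W \<inter> {d j<..<d (Suc j)}) h)"
    for i j
  have "\<exists>j. \<forall>i. E i (j i) \<and> j i < j (Suc i)"
  proof (rule dependent_nat_choice)
    show "\<exists>j. E 0 j" using pieces[of 0 0] unfolding E_def by blast
    show "\<exists>k. E (Suc i) k \<and> j < k" for i j
      using pieces[of "Suc j" "Suc i"] unfolding E_def by (auto simp: Suc_le_eq)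
  qed
  then obtain j where j: "\<forall>i. E i (j i) \<and> j i < j (Suc i)" ..
  then have "\<forall>i. \<exists>h. label_embedding le A (V \<inter> {c i<..<c (Suc i)}) B (W \<inter> {d (j i)<..<d (Suc (j i))}) h"
    unfolding E_def by simp
  from choice[OF this] obtain f
    where f: "\<And>i. label_embedding le A (V \<inter> {c i<..<c (Suc i)}) B (W \<inter> {d (j i)<..<d (Suc (j i))}) (f i)"
    by blast
  have j_mono: "strict_mono j" using j by (simp add: strict_mono_Suc_iff)
  \<comment> \<open>The index of the piece that contains \<open>p\<close>.\<close>
  define idx where "idx p = (SOME i. c i < p \<and> p < c (Suc i))" for p
  have idx: "c (idx p) < p" "p < c (Suc (idx p))" if "p \<in> V" "c 0 < p" "p < x" for p
  proof -
    have "\<exists>n. p < c n"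
      using order_tendstoD(1)[OF c(2) \<open>p < x\<close>] by (auto simp: eventually_sequentially)
    then have n: "p < c (LEAST n. p < c n)" by (rule LeastI_ex)
    then obtain i where i: "(LEAST n. p < c n) = Suc i"
      using \<open>c 0 < p\<close> by (cases "LEAST n. p < c n") auto
    then have "\<not> p < c i" using not_less_Least[of i "\<lambda>n. p < c n"] by simp
    moreover have "c i \<noteq> p" using c(3) that by blast
    ultimately have "c i < p \<and> p < c (Suc i)" using n i by simp
    then have "c (idx p) < p \<and> p < c (Suc (idx p))" unfolding idx_def by (rule someI)
    then show "c (idx p) < p" "p < c (Suc (idx p))" by simp_all
  qed
  have idx_ge: "n \<le> idx p" if "p \<in> V" "c 0 < p" "p < x" "c n \<le> p" for n p
  proof (rule ccontr)
    assume "\<not> n \<le> idx p"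
    then have "c (Suc (idx p)) \<le> c n" using incseqD[OF c(1)] by simp
    then show False using idx(2)[OF that(1-3)] that(4) by simp
  qed
  have idx_eq: "idx p = i" if "p \<in> V" "c i < p" "p < c (Suc i)" "p < x" for i p
  proof -
    have p0: "c 0 < p" using that incseqD[OF c(1), of 0 i] by simp
    have "i \<le> idx p" using idx_ge[OF that(1) p0] that by simp
    moreover have "idx p \<le> i"
    proof (rule ccontr)
      assume "\<not> idx p \<le> i"
      then have "c (Suc i) \<le> c (idx p)" using incseqD[OF c(1)] by simp
      then show False using idx(1)[OF that(1) p0 that(4)] that(3) by simp
    qed
    ultimately show ?thesis by simp
  qed
  define h where "h p = (if p < x then f (idx p) p else y)" for p
  have mem: "p \<in> V \<inter> {c (idx p)<..<c (Suc (idx p))}" if "p \<in> V \<inter> {c 0<..x}" "p < x" for p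
    using idx[of p] that by auto
  have h_in: "h p \<in> W" "d (j (idx p)) < h p" "h p < d (Suc (j (idx p)))"
    if "p \<in> V \<inter> {c 0<..x}" "p < x" for p
    using label_embeddingD(1)[OF f mem[OF that]] that(2) by (auto simp: h_def)
  have h_y: "h p \<le> y" if "p \<in> V \<inter> {c 0<..x}" for p
    using h_in(3)[OF that] d(3)[of "Suc (j (idx p))"] by (cases "p < x") (auto simp: h_def)
  have "label_embedding le A (V \<inter> {c 0<..x}) B (W \<inter> {d 0<..y}) h"
  proof (rule label_embeddingI)
    fix p assume p: "p \<in> V \<inter> {c 0<..x}"
    show "h p \<in> W \<inter> {d 0<..y}"
    proof (cases "p < x")
      case True
      then show ?thesis using h_in[OF p True] h_y[OF p] incseqD[OF d(1), of 0 "j (idx p)"] by auto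
    next
      case False
      then show ?thesis using y d(3) by (simp add: h_def)
    qed
    show "le (the (A p)) (the (B (h p)))"
    proof (cases "p < x")
      case True
      then show ?thesis using label_embeddingD(2)[OF f mem[OF p True]] by (simp add: h_def)
    next
      case False
      then show ?thesis using p xy by (simp add: h_def)
    qed
    show "h p < h q" if q: "q \<in> V \<inter> {c 0<..x}" and pq: "p < q" for q
    proof -
      have px: "p < x" using pq q by simp
      show ?thesis
      proof (cases "q < x")
        case False
        then show ?thesis using h_in(3)[OF p px] d(3)[of "Suc (j (idx p))"] by (simp add: h_def)
      next
        case True
        have "idx p \<le> idx q"
          using idx_ge[of q "idx p"] q True idx(1)[of p] p px pq by simp
        then consider "idx p = idx q" | "idx p < idx q" by linarith
        then show ?thesis
        proof cases
          case 1
          then show ?thesis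
            using label_embeddingD(4)[OF f mem[OF p px], of q] mem[OF q True] px True pq
            by (simp add: h_def)
        next
          case 2
          have "h p < d (Suc (j (idx p)))" by (rule h_in(3)[OF p px])
          also have "\<dots> \<le> d (j (idx q))"
            using incseqD[OF d(1)] 2 strict_monoD[OF j_mono 2] by simp
          also have "\<dots> < h q" by (rule h_in(2)[OF q True])
          finally show ?thesis .
        qed
      qed
    qed
    show "(h \<longlongrightarrow> h p) (at p within V \<inter> {c 0<..x})"
    proof (cases "p < x")
      case True
      define i where "i = idx p"
      have i: "p \<in> V \<inter> {c i<..<c (Suc i)}" using mem[OF p True] by (simp add: i_def)
      show ?thesis
      proof (rule tendsto_within_local[OF label_embeddingD(3)[OF f i]])
        show "open ({c i<..<c (Suc i)} \<inter> {..<x})" by (intro open_Int) auto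
        show "h q = f i q" if "q \<in> V \<inter> {c 0<..x} \<inter> ({c i<..<c (Suc i)} \<inter> {..<x})" for q
          using that idx_eq[of q i] by (simp add: h_def)
      qed (use i True p in auto)
    next
      case False
      then have px: "p = x" using p by simp
      have "(h \<longlongrightarrow> y) (at x within V \<inter> {c 0<..x})"
      proof (rule order_tendstoI)
        fix a assume "a < y"
        then obtain n where n: "a < d n"
          using order_tendstoD(1)[OF d(2)] by (auto simp: eventually_sequentially)
        have cx: "c n < x"
        proof -
          have "c n \<le> x" using c(1,2) by (rule incseq_le)
          then show ?thesis using c(3)[of n] x by (metis le_less)
        qed
        have "a < h q" if "q \<in> V \<inter> {c 0<..x}" "c n < q" for q
        proof (cases "q < x")
          case True
          have "n \<le> idx q" using idx_ge[of q n] that True by simp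
          also have "\<dots> \<le> j (idx q)" using j_mono by (rule seq_suble)
          finally have "d n \<le> d (j (idx q))" using incseqD[OF d(1)] by simp
          then show ?thesis using n h_in(2)[OF that(1) True] by simp
        next
          case False
          then show ?thesis using \<open>a < y\<close> by (simp add: h_def)
        qed
        then show "\<forall>\<^sub>F q in at x within V \<inter> {c 0<..x}. a < h q"
          unfolding eventually_at_topological using cx by (intro exI[of _ "{c n<..}"]) auto
      next
        fix a assume "y < a"
        then have "h q < a" if "q \<in> V \<inter> {c 0<..x}" for q using h_y[OF that] by simp
        then show "\<forall>\<^sub>F q in at x within V \<inter> {c 0<..x}. h q < a"
          unfolding eventually_at_topological by (intro exI[of _ UNIV]) auto
      qed
      then show ?thesis using px by (simp add: h_def)
    qed
  qed
  moreover have "h x = y" by (simp add: h_def)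
  ultimately show ?thesis by blast
qed

lemma label_embedding_reflect:
  assumes "label_embedding le A V B W h"
  shows "label_embedding le (\<lambda>x. A (- x)) (uminus ` V) (\<lambda>x. B (- x)) (uminus ` W) (\<lambda>x. - h (- x))"
proof (rule label_embeddingI)
  fix x assume "x \<in> uminus ` V"
  then have x: "- x \<in> V" by auto
  note hx = label_embeddingD[OF assms x]
  show "- h (- x) \<in> uminus ` W" using hx(1) by simp
  show "le (the (A (- x))) (the (B (- (- h (- x)))))" using hx(2) by simp
  have "((\<lambda>x. h (- x)) \<longlongrightarrow> h (- x)) (at x within uminus ` V)"
  proof (rule tendsto_compose_within[where f = uminus and g = h])
    show "(uminus \<longlongrightarrow> - x) (at x within uminus ` V)" by (intro tendsto_intros)
    show "(h \<longlongrightarrow> h (- x)) (at (- x) within uminus ` uminus ` V)"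
      using hx(3) by (simp add: image_image)
  qed
  then show "((\<lambda>x. - h (- x)) \<longlongrightarrow> - h (- x)) (at x within uminus ` V)" by (rule tendsto_minus)
  show "- h (- x) < - h (- y)" if "y \<in> uminus ` V" "x < y" for y
    using that label_embeddingD(4)[OF assms, of "- y" "- x"] x by auto
qed

lemma label_embedding_right_limit:
  fixes c d :: "nat \<Rightarrow> real"
  assumes c: "decseq c" "c \<longlonglongrightarrow> x" "\<And>i. c i \<notin> V"
    and d: "decseq d" "d \<longlonglongrightarrow> y" "\<And>i. y < d i"
    and x: "x \<in> V" and y: "y \<in> W" and xy: "le (the (A x)) (the (B y))"
    and pieces: "\<And>i n. \<exists>j\<ge>n. \<exists>h. label_embedding le A (V \<inter> {c (Suc i)<..<c i}) B (W \<inter> {d (Suc j)<..<d j}) h"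
  shows "\<exists>h. label_embedding le A (V \<inter> {x..<c 0}) B (W \<inter> {y..<d 0}) h \<and> h x = y"
proof -
  have img: "uminus ` (S \<inter> {a<..<b}) = uminus ` S \<inter> {- b<..<- a}"
    "uminus ` (S \<inter> {a..<b}) = uminus ` S \<inter> {- b<..- a}"
    "uminus ` (S \<inter> {a<..b}) = uminus ` S \<inter> {- b..<- a}" for S and a b :: real
    by (auto simp: image_Int)
  have "\<exists>h. label_embedding le (\<lambda>x. A (- x)) (uminus ` V \<inter> {- c 0<..- x})
      (\<lambda>x. B (- x)) (uminus ` W \<inter> {- d 0<..- y}) h \<and> h (- x) = - y"
  proof (rule label_embedding_left_limit)
    show "incseq (\<lambda>i. - c i)" "incseq (\<lambda>i. - d i)"
      using c(1) d(1) by (simp_all add: decseq_eq_incseq)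
    show "(\<lambda>i. - c i) \<longlonglongrightarrow> - x" "(\<lambda>i. - d i) \<longlonglongrightarrow> - y"
      using c(2) d(2) by (auto intro: tendsto_minus)
    show "- c i \<notin> uminus ` V" for i using c(3) by auto
    show "- d i < - y" for i using d(3) by simp
    show "- x \<in> uminus ` V" "- y \<in> uminus ` W" using x y by auto
    show "le (the (A (- (- x)))) (the (B (- (- y))))" using xy by simp
    fix i n
    obtain j h where j: "n \<le> j"
      and h: "label_embedding le A (V \<inter> {c (Suc i)<..<c i}) B (W \<inter> {d (Suc j)<..<d j}) h"
      using pieces by blast
    show "\<exists>j\<ge>n. \<exists>h. label_embedding le (\<lambda>x. A (- x)) (uminus ` V \<inter> {- c i<..<- c (Suc i)})
        (\<lambda>x. B (- x)) (uminus ` W \<inter> {- d j<..<- d (Suc j)}) h"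
      using j label_embedding_reflect[OF h] unfolding img by blast
  qed
  then obtain h where h: "label_embedding le (\<lambda>x. A (- x)) (uminus ` V \<inter> {- c 0<..- x})
      (\<lambda>x. B (- x)) (uminus ` W \<inter> {- d 0<..- y}) h" and hx: "h (- x) = - y" by blast
  have "label_embedding le A (V \<inter> {x..<c 0}) B (W \<inter> {y..<d 0}) (\<lambda>x. - h (- x))"
    using label_embedding_reflect[OF h] unfolding img by (simp add: image_image)
  then show ?thesis using hx by (intro exI[of _ "\<lambda>x. - h (- x)"]) simp
qed

section \<open>Decomposed labelled sets\<close>

text \<open>Decomposed labelled sets as trees.  \<open>Node A x ch\<close> stands for the labelled set \<open>A\<close> with the distinguished point \<open>x\<close>
  and the parts \<open>ch k i\<close>: the first part for \<open>k = 0\<close>, the parts on the left of \<open>x\<close> for \<open>k = 1\<close>, those on the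
  right for \<open>k = 2\<close>, and the last part for \<open>k = 3\<close>.  The first and the last part are treated as
  constant sequences; for \<open>k > 3\<close>, the parts are the last part again.\<close>

datatype 'a lobject = Empty | Node "real \<rightharpoonup> 'a" real "nat \<Rightarrow> nat \<Rightarrow> 'a lobject"

text \<open>The labelled set that a tree stands for.\<close>

primrec lmap :: "'a lobject \<Rightarrow> real \<rightharpoonup> 'a" where
  "lmap Empty = Map.empty"
| "lmap (Node A x ch) = A"

text \<open>The label of the distinguished point; the value at \<open>Empty\<close> is never used.\<close>

primrec top_label :: "'a lobject \<Rightarrow> 'a" where
  "top_label Empty = undefined"
| "top_label (Node A x ch) = the (A x)"

text \<open>The parts; those of \<open>Empty\<close> are again empty.\<close>

primrec child :: "'a lobject \<Rightarrow> nat \<Rightarrow> nat \<Rightarrow> 'a lobject" where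
  "child Empty = (\<lambda>_ _. Empty)"
| "child (Node A x ch) = ch"

text \<open>The intervals cut out by a sequence \<open>c\<close> that increases to a point and a sequence \<open>e\<close> that decreases to it.\<close>

definition piece :: "(nat \<Rightarrow> real) \<Rightarrow> (nat \<Rightarrow> real) \<Rightarrow> nat \<Rightarrow> nat \<Rightarrow> real set" where
  "piece c e k i = (if k = 0 then {..<c 0} else if k = 1 then {c i<..<c (Suc i)}
     else if k = 2 then {e (Suc i)<..<e i} else {e 0<..})"

text \<open>\<open>c\<close> and \<open>e\<close> converge to \<open>x\<close> from the left and from the right and avoid \<open>V\<close>.  They are only weakly monotone,
  which allows empty pieces.\<close>

definition cuts :: "real set \<Rightarrow> real \<Rightarrow> (nat \<Rightarrow> real) \<Rightarrow> (nat \<Rightarrow> real) \<Rightarrow> bool" where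
  "cuts V x c e \<longleftrightarrow> incseq c \<and> c \<longlonglongrightarrow> x \<and> (\<forall>i. c i < x \<and> c i \<notin> V) \<and>
     decseq e \<and> e \<longlonglongrightarrow> x \<and> (\<forall>i. x < e i \<and> e i \<notin> V)"

text \<open>Each member is below infinitely many members.\<close>

definition recurrent :: "('b \<Rightarrow> 'b \<Rightarrow> bool) \<Rightarrow> (nat \<Rightarrow> 'b) \<Rightarrow> bool" where
  "recurrent R f \<longleftrightarrow> (\<forall>i n. \<exists>j\<ge>n. R (f i) (f j))"

text \<open>The trees that describe their labelled sets correctly, with recurrent sequences of parts on both sides.\<close>

inductive valid :: "('a \<Rightarrow> 'a \<Rightarrow> bool) \<Rightarrow> 'a lobject \<Rightarrow> bool" for le where
  valid_Empty: "valid le Empty"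
| valid_Node: "\<lbrakk>x \<in> dom A; cuts (dom A) x c e; \<And>k i. lmap (ch k i) = A |` piece c e k i;
     \<And>k. k \<in> {1, 2} \<Longrightarrow> recurrent (smc_embeddable le) (\<lambda>i. lmap (ch k i));
     \<And>k i. valid le (ch k i)\<rbrakk> \<Longrightarrow> valid le (Node A x ch)"

lemma ran_restrict_subset: "ran (A |` S) \<subseteq> ran A"
  by (auto simp: ran_def restrict_map_def)

text \<open>Two decomposed sets compare if their points and their parts do.\<close>

lemma Node_embeddable:
  assumes qo: "quasi_order_on Q le" and ran: "ran A \<subseteq> Q" "ran B \<subseteq> Q"
    and A: "valid le (Node A x ch)" and B: "valid le (Node B y ch')"
    and xy: "le (the (A x)) (the (B y))"
    and chs: "\<And>k i. k < 4 \<Longrightarrow> \<exists>j. smc_embeddable le (lmap (ch k i)) (lmap (ch' k j))"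
  shows "smc_embeddable le A B"
proof -
  have tr: "transp_on Q le" using qo by (simp add: quasi_order_on_def)
  obtain c e where x: "x \<in> dom A" and ce: "cuts (dom A) x c e"
    and ch: "\<And>k i. lmap (ch k i) = A |` piece c e k i"
    using A by cases auto
  obtain d f where y: "y \<in> dom B" and df: "cuts (dom B) y d f"
    and ch': "\<And>k i. lmap (ch' k i) = B |` piece d f k i"
    and rec: "\<And>k. k \<in> {1, 2} \<Longrightarrow> recurrent (smc_embeddable le) (\<lambda>i. lmap (ch' k i))"
    using B by cases auto
  have rs: "ran (A |` S) \<subseteq> Q" "ran (B |` S) \<subseteq> Q" for S
    using order_trans[OF ran_restrict_subset ran(1)] order_trans[OF ran_restrict_subset ran(2)] .
  have far: "\<exists>j\<ge>n. \<exists>h. label_embedding le A (dom A \<inter> piece c e k i) B (dom B \<inter> piece d f k j) h"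
    if k: "k \<in> {1, 2}" for k i n
  proof -
    obtain j0 where j0: "smc_embeddable le (lmap (ch k i)) (lmap (ch' k j0))"
      using chs[of k i] k by auto
    obtain j where j: "n \<le> j" "smc_embeddable le (lmap (ch' k j0)) (lmap (ch' k j))"
      using rec[OF k] unfolding recurrent_def by blast
    have "smc_embeddable le (A |` piece c e k i) (B |` piece d f k j)"
      by (rule smc_embeddable_trans[OF tr rs(1) rs(2) rs(2) j0[unfolded ch ch'] j(2)[unfolded ch']])
    then show ?thesis using j(1) unfolding smc_embeddable_restrict_iff by blast
  qed
  have left: "\<exists>h. label_embedding le A (dom A \<inter> {c 0<..x}) B (dom B \<inter> {d 0<..y}) h \<and> h x = y"
    using ce df x y xy far[of 1]
    by (intro label_embedding_left_limit) (auto simp: cuts_def piece_def)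
  have right: "\<exists>h. label_embedding le A (dom A \<inter> {x..<e 0}) B (dom B \<inter> {y..<f 0}) h \<and> h x = y"
    using ce df x y xy far[of 2]
    by (intro label_embedding_right_limit) (auto simp: cuts_def piece_def)
  have c0: "c 0 < x" "c 0 \<notin> dom A" "x < e 0" "e 0 \<notin> dom A" and d0: "d 0 < y" "y < f 0"
    using ce df by (auto simp: cuts_def)
  obtain h1 h2 where h1: "label_embedding le A (dom A \<inter> {c 0<..x}) B (dom B \<inter> {d 0<..y}) h1" "h1 x = y"
    and h2: "label_embedding le A (dom A \<inter> {x..<e 0}) B (dom B \<inter> {y..<f 0}) h2" "h2 x = y"
    using left right by blast
  define V where "V = dom A \<inter> {c 0<..<e 0}"
  define W where "W = dom B \<inter> {d 0<..<f 0}"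
  have sets: "V \<inter> {..x} = dom A \<inter> {c 0<..x}" "V \<inter> {x..} = dom A \<inter> {x..<e 0}"
    "W \<inter> {..y} = dom B \<inter> {d 0<..y}" "W \<inter> {y..} = dom B \<inter> {y..<f 0}"
    using c0 d0 by (auto simp: V_def W_def)
  have mid: "\<exists>h. label_embedding le A V B W h"
    using label_embedding_glue_point[of le A V x B W y h1 h2] h1 h2 c0 x unfolding sets
    by (auto simp: V_def)
  define V' where "V' = dom A \<inter> {c 0<..}"
  define W' where "W' = dom B \<inter> {d 0<..}"
  have sets': "V' \<inter> {..<e 0} = V" "V' \<inter> {e 0<..} = dom A \<inter> {e 0<..}"
    "W' \<inter> {..<f 0} = W" "W' \<inter> {f 0<..} = dom B \<inter> {f 0<..}"
    using c0 d0 by (auto simp: V_def W_def V'_def W'_def)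
  have "\<exists>h. label_embedding le A (dom A \<inter> {e 0<..}) B (dom B \<inter> {f 0<..}) h"
    using chs[of 3 0] unfolding ch ch' smc_embeddable_restrict_iff by (simp add: piece_def)
  with mid have mid': "\<exists>h. label_embedding le A V' B W' h"
    using label_embedding_glue_cut[of le A V' "e 0" B W' "f 0"] c0 unfolding sets'
    by (auto simp: V'_def)
  have "\<exists>h. label_embedding le A (dom A \<inter> {..<c 0}) B (dom B \<inter> {..<d 0}) h"
    using chs[of 0 0] unfolding ch ch' smc_embeddable_restrict_iff by (simp add: piece_def)
  with mid' show ?thesis
    using label_embedding_glue_cut[of le A "dom A" "c 0" B "dom B" "d 0"] c0
    unfolding smc_embeddable_iff V'_def W'_def by auto
qed

text \<open>The decomposed sets with labels in \<open>Q\<close>.\<close>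

definition lobjects :: "'a set \<Rightarrow> ('a \<Rightarrow> 'a \<Rightarrow> bool) \<Rightarrow> 'a lobject set" where
  "lobjects Q le = {t. valid le t \<and> ran (lmap t) \<subseteq> Q}"

abbreviation lobject_le :: "('a \<Rightarrow> 'a \<Rightarrow> bool) \<Rightarrow> 'a lobject \<Rightarrow> 'a lobject \<Rightarrow> bool" where
  "lobject_le le s t \<equiv> smc_embeddable le (lmap s) (lmap t)"

lemma lobjects_child:
  assumes "reflp_on Q le" "t \<in> lobjects Q le"
  shows "child t k i \<in> lobjects Q le" "lobject_le le (child t k i) t"
proof -
  have "valid le t" "ran (lmap t) \<subseteq> Q" using assms(2) by (auto simp: lobjects_def)
  then have "child t k i \<in> lobjects Q le \<and> lobject_le le (child t k i) t"
  proof cases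
    case valid_Empty
    then show ?thesis by (auto simp: lobjects_def valid.intros intro: smc_embeddable_empty)
  next
    case (valid_Node x A c e ch)
    have "smc_embeddable le (A |` piece c e k i) (A |` UNIV)"
      using assms(1) \<open>ran (lmap t) \<subseteq> Q\<close> valid_Node(1) by (intro smc_embeddable_mono) auto
    then have "smc_embeddable le (A |` piece c e k i) A" by (simp add: restrict_map_def)
    moreover have "ran (A |` piece c e k i) \<subseteq> Q"
      using \<open>ran (lmap t) \<subseteq> Q\<close> valid_Node(1) ran_restrict_subset[of A "piece c e k i"] by auto
    ultimately show ?thesis using valid_Node by (simp add: lobjects_def)
  qed
  then show "child t k i \<in> lobjects Q le" "lobject_le le (child t k i) t" by simp_all
qed

lemma wf_child: "wf {(s, t). t \<noteq> Empty \<and> (\<exists>k i. s = child t k i)}"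
  unfolding wf_def
proof (intro allI impI)
  fix P :: "'a lobject \<Rightarrow> bool" and t
  assume step: "\<forall>t. (\<forall>s. (s, t) \<in> {(s, t). t \<noteq> Empty \<and> (\<exists>k i. s = child t k i)} \<longrightarrow> P s) \<longrightarrow> P t"
  show "P t"
    by (induction t) (rule step[rule_format], auto)+
qed

text \<open>Decomposed sets over a better-quasi-ordering have no bad array.  In a minimal bad array, the
  embedding of \<open>F X\<close> in \<open>F (tail X)\<close> fails at the labels or at one of the four families of parts.\<close>

theorem no_bad_lobject_array:
  assumes bqo: "bqo_on Q le"
  shows "\<not> bad_array (lobjects Q le) (lobject_le le) A F m"
proof
  assume ex: "bad_array (lobjects Q le) (lobject_le le) A F m"
  let ?U = "lobjects Q le" and ?R = "lobject_le le"
  have qo: "quasi_order_on Q le" using bqo by (simp add: bqo_on_def)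
  then have refl: "reflp_on Q le" and tr: "transp_on Q le" by (simp_all add: quasi_order_on_def)
  define S0 where "S0 = {(s, t). t \<in> ?U \<and> t \<noteq> Empty \<and> (\<exists>k i. s = child t k i)}"
  have ranU: "ran (lmap t) \<subseteq> Q" if "t \<in> ?U" for t using that by (simp add: lobjects_def)
  have below: "s \<in> ?U \<and> ?R s t" if "(s, t) \<in> S0\<^sup>+" "t \<in> ?U" for s t
    using that(1)
  proof (induction rule: converse_trancl_induct)
    case (base s)
    then show ?case using lobjects_child[OF refl] by (auto simp: S0_def)
  next
    case (step r s)
    then have "r \<in> ?U" "?R r s" using lobjects_child[OF refl] by (auto simp: S0_def)
    then show ?case
      using step.IH smc_embeddable_trans[OF tr, of "lmap r" "lmap s" "lmap t"] ranU that(2) by auto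
  qed
  have "\<exists>A F m. bad_array ?U ?R A F m \<and> (\<forall>B G n. bad_array ?U ?R B G n \<and> B \<subseteq> A \<longrightarrow>
     (\<exists>X\<in>inf_subsets B. \<not> (m X < n X \<and> (G X, F X) \<in> S0\<^sup>+)))"
  proof (rule minimal_bad_array[OF _ _ _ ex])
    have "S0 \<subseteq> {(s, t). t \<noteq> Empty \<and> (\<exists>k i. s = child t k i)}" by (auto simp: S0_def)
    then show "wf (S0\<^sup>+)" by (intro wf_trancl wf_subset[OF wf_child])
    show "?R a c" if "a \<in> ?U" "b \<in> ?U" "c \<in> ?U" "?R a b" "(b, c) \<in> S0\<^sup>+" for a b c
      using smc_embeddable_trans[OF tr, of "lmap a" "lmap b" "lmap c"] that ranU below[of b c] by auto
  qed simp
  then obtain A F m where bad: "bad_array ?U ?R A F m"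
    and min: "\<And>B G n. bad_array ?U ?R B G n \<Longrightarrow> B \<subseteq> A \<Longrightarrow>
      \<exists>X\<in>inf_subsets B. \<not> (m X < n X \<and> (G X, F X) \<in> S0\<^sup>+)"
    by (elim exE conjE) simp
  note arr = bad_arrayD(1)[OF bad] and FU = bad_arrayD(2)[OF bad] and FR = bad_arrayD(3)[OF bad]
  have nonempty: "F X \<noteq> Empty" if X: "X \<in> inf_subsets A" for X
    using FR[OF X] smc_embeddable_empty[of "lmap (F X)"] by auto
  \<comment> \<open>\<open>P 0\<close>: the labels do not compare; \<open>P (Suc k)\<close>: some part of family \<open>k\<close> does not embed.\<close>
  define P where "P k s t \<longleftrightarrow> (case k of 0 \<Rightarrow> \<not> le (top_label s) (top_label t)
    | Suc k \<Rightarrow> \<exists>i. \<forall>j. \<not> ?R (child s k i) (child t k j))" for k and s t :: "'a lobject"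
  have P0: "P 0 s t \<longleftrightarrow> \<not> le (top_label s) (top_label t)"
    and PS: "P (Suc k) s t \<longleftrightarrow> (\<exists>i. \<forall>j. \<not> ?R (child s k i) (child t k j))" for k s t
    by (simp_all add: P_def)
  have "\<exists>B\<in>inf_subsets A. \<exists>k<5. \<forall>X\<in>inf_subsets B. P k (F X) (F (tail X))"
  proof (rule clopen_Ramsey[OF array_infinite[OF arr]])
    show "clopen_on A (\<lambda>X. P k (F X) (F (tail X)))" for k by (rule clopen_on_array[OF arr])
    fix X assume X: "X \<in> inf_subsets A"
    obtain C x ch where C: "F X = Node C x ch" using nonempty[OF X] by (cases "F X") auto
    obtain D y ch' where D: "F (tail X) = Node D y ch'"
      using nonempty[OF tail_in[OF X]] by (cases "F (tail X)") auto
    show "\<exists>k<5. P k (F X) (F (tail X))"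
    proof (rule ccontr)
      assume "\<not> ?thesis"
      then have no: "\<not> P k (F X) (F (tail X))" if "k < 5" for k using that by blast
      have "smc_embeddable le C D"
      proof (rule Node_embeddable[OF qo])
        show "ran C \<subseteq> Q" "ran D \<subseteq> Q" "valid le (Node C x ch)" "valid le (Node D y ch')"
          using FU[OF X] FU[OF tail_in[OF X]] by (auto simp: lobjects_def C D)
        show "le (the (C x)) (the (D y))" using no[of 0] by (simp add: P0 C D)
        show "\<exists>j. smc_embeddable le (lmap (ch k i)) (lmap (ch' k j))" if "k < 4" for k i
          using no[of "Suc k"] that by (simp add: PS C D)
      qed
      then show False using FR[OF X] by (simp add: C D)
    qed
  qed
  then obtain B k where B: "B \<in> inf_subsets A" and k: "\<forall>X\<in>inf_subsets B. P k (F X) (F (tail X))"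
    by blast
  have BA: "B \<subseteq> A" using B by (simp add: inf_subsets_def)
  have sub: "X \<in> inf_subsets A" if "X \<in> inf_subsets B" for X using that inf_subsets_mono[OF BA] by blast
  have arrB: "array B F m" by (rule array_subset[OF arr B])
  show False
  proof (cases k)
    case 0
    obtain m' where "array B (\<lambda>X. top_label (F X)) m'"
      using array_modulus_tail[OF arrB, of "\<lambda>s _. top_label s"] by blast
    then have "bad_array Q le B (\<lambda>X. top_label (F X)) m'"
    proof (rule bad_arrayI)
      fix X assume X: "X \<in> inf_subsets B"
      have "valid le (F X)" "ran (lmap (F X)) \<subseteq> Q" using FU[OF sub[OF X]] by (auto simp: lobjects_def)
      then show "top_label (F X) \<in> Q"
        using nonempty[OF sub[OF X]] by cases (auto simp: ran_def)
      show "\<not> le (top_label (F X)) (top_label (F (tail X)))" using k X 0 P0 by simp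
    qed
    then show False using bqo_on_no_bad_array[OF bqo] by blast
  next
    case (Suc l)
    \<comment> \<open>A part that does not embed, chosen depending on \<open>F X\<close> and \<open>F (tail X)\<close> only.\<close>
    define G where "G s t = child s l (SOME i. \<forall>j. \<not> ?R (child s l i) (child t l j))" for s t
    obtain m' where m': "array B (\<lambda>X. G (F X) (F (tail X))) m'" "\<forall>X\<in>inf_subsets B. m X < m' X"
      using array_modulus_tail[OF arrB, of G] by blast
    have "bad_array ?U ?R B (\<lambda>X. G (F X) (F (tail X))) m'"
      using m'(1)
    proof (rule bad_arrayI)
      fix X assume X: "X \<in> inf_subsets B"
      show "G (F X) (F (tail X)) \<in> ?U"
        unfolding G_def by (rule lobjects_child(1)[OF refl FU[OF sub[OF X]]])
      have "\<exists>i. \<forall>j. \<not> ?R (child (F X) l i) (child (F (tail X)) l j)"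
        using k X Suc PS by simp
      from someI_ex[OF this] have "\<not> ?R (G (F X) (F (tail X))) (child (F (tail X)) l j)" for j
        unfolding G_def by blast
      then show "\<not> ?R (G (F X) (F (tail X))) (G (F (tail X)) (F (tail (tail X))))"
        unfolding G_def[of "F (tail X)"] .
    qed
    from min[OF this BA] obtain X where X: "X \<in> inf_subsets B"
      and not: "\<not> (m X < m' X \<and> (G (F X) (F (tail X)), F X) \<in> S0\<^sup>+)" by blast
    have "(G (F X) (F (tail X)), F X) \<in> S0"
      using FU[OF sub[OF X]] nonempty[OF sub[OF X]] by (auto simp: S0_def G_def)
    then show False using not m'(2) X by auto
  qed
qed

lemma no_bad_array_imp_good_pair:
  fixes p :: "nat \<Rightarrow> 'a"
  assumes "\<And>A F m. \<not> bad_array U R A F m" "\<And>n. p n \<in> U"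
  shows "\<exists>n k. n < k \<and> R (p n) (p k)"
proof (rule ccontr)
  assume no: "\<not> ?thesis"
  have "bad_array U R UNIV (\<lambda>X. p (Inf X)) Inf"
  proof (rule bad_arrayI)
    show "array UNIV (\<lambda>X. p (Inf X)) Inf"
    proof (rule arrayI)
      show "Inf X \<in> X" if "X \<in> inf_subsets UNIV" for X
        using that Inf_in by (auto simp: inf_subsets_def)
      fix X Y assume "X \<in> inf_subsets UNIV" "agree (Inf X) X Y"
      then have "Inf Y = Inf X" using Inf_in by (intro agree_Inf) (auto simp: inf_subsets_def)
      then show "Inf Y = Inf X" "p (Inf Y) = p (Inf X)" by simp_all
    qed simp
    fix X assume X: "X \<in> inf_subsets UNIV"
    show "p (Inf X) \<in> U" by (rule assms(2))
    have "Inf (tail X) \<in> tail X" using tail_in[OF X] Inf_in by (auto simp: inf_subsets_def)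
    then have "Inf (tail X) \<in> X" "Inf (tail X) \<noteq> Inf X" by (auto simp: tail_def)
    then have "Inf X < Inf (tail X)" using cInf_lower[of "Inf (tail X)" X] by simp
    then show "\<not> R (p (Inf X)) (p (Inf (tail X)))" using no by blast
  qed
  then show False using assms(1) by blast
qed

text \<open>In a well-quasi-ordering, all but finitely many members of a sequence are below infinitely many
  members.\<close>

lemma eventually_recurrent:
  fixes p :: "nat \<Rightarrow> 'a"
  assumes "\<And>p :: nat \<Rightarrow> 'a. (\<And>n. p n \<in> U) \<Longrightarrow> \<exists>n k. n < k \<and> R (p n) (p k)"
    and "\<And>n. p n \<in> U"
  shows "\<exists>N. \<forall>i\<ge>N. \<forall>n. \<exists>j\<ge>n. R (p i) (p j)"
proof (rule ccontr)
  assume "\<not> ?thesis"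
  then have no: "\<exists>i\<ge>N. \<exists>n. \<forall>j\<ge>n. \<not> R (p i) (p j)" for N
    by (simp only: not_ex not_all not_imp bex_simps) simp
  define isolated where "isolated i \<longleftrightarrow> (\<exists>n. \<forall>j\<ge>n. \<not> R (p i) (p j))" for i
  have "\<exists>f. \<forall>s::nat. isolated (f s) \<and> (f s < f (Suc s) \<and> (\<forall>j\<ge>f (Suc s). \<not> R (p (f s)) (p j)))"
  proof (rule dependent_nat_choice)
    show "\<exists>i. isolated i" using no unfolding isolated_def by blast
    fix i and s :: nat assume "isolated i"
    then obtain n where n: "\<forall>j\<ge>n. \<not> R (p i) (p j)" unfolding isolated_def by blast
    obtain i' where "i' \<ge> max n (Suc i)" "isolated i'" using no unfolding isolated_def by blast
    then show "\<exists>i'. isolated i' \<and> (i < i' \<and> (\<forall>j\<ge>i'. \<not> R (p i) (p j)))"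
      using n by (intro exI[of _ i']) auto
  qed
  then obtain f where f: "\<forall>s::nat. isolated (f s) \<and> (f s < f (Suc s) \<and> (\<forall>j\<ge>f (Suc s). \<not> R (p (f s)) (p j)))" ..
  then have mono: "strict_mono f" by (simp add: strict_mono_Suc_iff)
  obtain s t where st: "s < t" "R (p (f s)) (p (f t))" using assms(1)[of "p \<circ> f"] assms(2) by auto
  have "f (Suc s) \<le> f t" using mono st(1) by (simp add: strict_mono_less_eq Suc_le_eq)
  then show False using f st(2) by blast
qed

section \<open>Decomposing closed countable sets\<close>

text \<open>\<open>A\<close> is described by some tree.\<close>

definition decomposable :: "('a \<Rightarrow> 'a \<Rightarrow> bool) \<Rightarrow> (real \<rightharpoonup> 'a) \<Rightarrow> bool" where
  "decomposable le A \<longleftrightarrow> (\<exists>t. valid le t \<and> lmap t = A)"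

lemma decomposable_empty: "dom A = {} \<Longrightarrow> decomposable le A"
  unfolding decomposable_def by (intro exI[of _ Empty]) (simp add: valid_Empty)

lemma restrict_map_eqI: "(\<And>p. p \<in> dom A \<Longrightarrow> p \<in> S \<longleftrightarrow> p \<in> T) \<Longrightarrow> A |` S = A |` T"
proof
  fix p assume "\<And>p. p \<in> dom A \<Longrightarrow> p \<in> S \<longleftrightarrow> p \<in> T"
  then show "(A |` S) p = (A |` T) p" by (cases "p \<in> dom A") (auto simp: restrict_map_def)
qed

text \<open>Appending on the right at a cut \<open>c\<close>, by recursion into the last part of the tree for the left
  piece.\<close>

lemma decomposable_append_aux:
  assumes "valid le t" "c \<notin> dom A" "lmap t = A |` {..<c}" "decomposable le (A |` {c<..})"
  shows "decomposable le A"
  using assms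
proof (induction arbitrary: A)
  case valid_Empty
  have "A = A |` {c<..}"
  proof
    fix p
    have "(A |` {..<c}) p = None" using valid_Empty.prems(2) by (metis lmap.simps(1))
    then show "A p = (A |` {c<..}) p"
      using valid_Empty.prems(1) by (cases p c rule: linorder_cases) (auto simp: restrict_map_def)
  qed
  then show ?case using valid_Empty.prems(3) by simp
next
  case (valid_Node x A1 c1 e1 ch)
  have A1: "A1 = A |` {..<c}" using valid_Node.prems(2) by simp
  have domA1: "dom A1 = dom A \<inter> {..<c}" by (simp add: A1)
  have x: "x \<in> dom A" "x < c" using valid_Node.hyps(1) domA1 by auto
  note cuts = valid_Node.hyps(2)[unfolded cuts_def domA1]
  \<comment> \<open>The right cuts of the left piece may lie beyond \<open>c\<close>; truncating them does not change its parts.\<close>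
  define e where "e i = min (e1 i) c" for i
  have cuts': "cuts (dom A) x c1 e"
    unfolding cuts_def
  proof (intro conjI allI)
    show "incseq c1" "c1 \<longlonglongrightarrow> x" using cuts by auto
    show "c1 i < x" for i using cuts by auto
    then have "c1 i < c" for i using x(2) by (meson less_trans)
    then show "c1 i \<notin> dom A" for i using cuts by blast
    have "min (e1 j) c \<le> min (e1 i) c" if "i \<le> j" for i j
      using cuts that by (intro min.mono) (auto simp: decseq_def)
    then show "decseq e" by (simp add: decseq_def e_def)
    have "(\<lambda>i. min (e1 i) c) \<longlonglongrightarrow> min x c" using cuts by (intro tendsto_min) auto
    then show "e \<longlonglongrightarrow> x" using x(2) by (simp add: e_def[abs_def] min_def)
    show "x < e i" for i using cuts x(2) by (simp add: e_def)
    show "e i \<notin> dom A" for i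
    proof (cases "e1 i < c")
      case True
      then show ?thesis using cuts by (auto simp: e_def min_def)
    next
      case False
      then show ?thesis using valid_Node.prems(1) by (auto simp: e_def min_def)
    qed
  qed
  have e0: "e 0 \<le> c" by (simp add: e_def)
  have "decomposable le (A |` {e 0<..})"
  proof (rule valid_Node.IH)
    show "c \<notin> dom (A |` {e 0<..})" using valid_Node.prems(1) by simp
    have "lmap (ch 3 0) = A |` ({..<c} \<inter> {e1 0<..})"
      using valid_Node.hyps(3)[of 3 0] by (simp add: piece_def A1)
    also have "\<dots> = (A |` {e 0<..}) |` {..<c}"
      by (simp, intro restrict_map_eqI) (auto simp: e_def)
    finally show "lmap (ch 3 0) = (A |` {e 0<..}) |` {..<c}" .
    have "(A |` {e 0<..}) |` {c<..} = A |` {c<..}"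
      by (simp, intro restrict_map_eqI) (use e0 in auto)
    then show "decomposable le ((A |` {e 0<..}) |` {c<..})" using valid_Node.prems(3) by simp
  qed
  then obtain t' where t': "valid le t'" "lmap t' = A |` {e 0<..}" unfolding decomposable_def by blast
  define ch' where "ch' k i = (if k < 3 then ch k i else t')" for k i
  have "valid le (Node A x ch')"
  proof (rule valid.valid_Node[OF x(1) cuts'])
    show "valid le (ch' k i)" for k i using valid_Node.hyps(5) t'(1) by (simp add: ch'_def)
    show "recurrent (smc_embeddable le) (\<lambda>i. lmap (ch' k i))" if "k \<in> {1, 2}" for k
      using valid_Node.hyps(4)[OF that] that by (auto simp: ch'_def)
    fix k i :: nat
    consider "k = 0" | "k = 1" | "k = 2" | "k \<ge> 3" by linarith
    then show "lmap (ch' k i) = A |` piece c1 e k i"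
    proof cases
      case 4
      then show ?thesis using t'(2) by (simp add: ch'_def piece_def)
    next
      case 1
      have "c1 0 < c" using cuts x(2) by (meson less_trans)
      then have "A |` ({..<c} \<inter> {..<c1 0}) = A |` {..<c1 0}" by (intro restrict_map_eqI) auto
      then show ?thesis using 1 valid_Node.hyps(3)[of 0 i] by (simp add: ch'_def piece_def A1)
    next
      case 2
      have "c1 (Suc i) < c" using cuts x(2) by (meson less_trans)
      then have "A |` ({..<c} \<inter> {c1 i<..<c1 (Suc i)}) = A |` {c1 i<..<c1 (Suc i)}"
        by (intro restrict_map_eqI) auto
      then show ?thesis using 2 valid_Node.hyps(3)[of 1 i] by (simp add: ch'_def piece_def A1)
    next
      case 3
      have "A |` ({..<c} \<inter> {e1 (Suc i)<..<e1 i}) = A |` {e (Suc i)<..<e i}"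
        by (intro restrict_map_eqI) (auto simp: e_def)
      then show ?thesis using 3 valid_Node.hyps(3)[of 2 i] by (simp add: ch'_def piece_def A1)
    qed
  qed
  then show ?case unfolding decomposable_def by (intro exI[of _ "Node A x ch'"]) simp
qed

lemma decomposable_append:
  assumes "decomposable le (A |` {u<..<w})" "decomposable le (A |` {w<..<v})"
    and w: "w \<notin> dom A" "u < w" "w < v"
  shows "decomposable le (A |` {u<..<v})"
proof -
  obtain t where t: "valid le t" "lmap t = A |` {u<..<w}"
    using assms(1) unfolding decomposable_def by blast
  have "(A |` {u<..<v}) |` {..<w} = A |` {u<..<w}"
    using w by (simp, intro restrict_map_eqI) auto
  moreover have "(A |` {u<..<v}) |` {w<..} = A |` {w<..<v}"
    using w by (simp, intro restrict_map_eqI) auto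
  ultimately show ?thesis
    using decomposable_append_aux[OF t(1), of w "A |` {u<..<v}"] t(2) w(1) assms(2) by simp
qed

lemma countable_avoid:
  fixes a b :: real
  assumes "countable V" "a < b"
  shows "\<exists>c. a < c \<and> c < b \<and> c \<notin> V"
proof -
  have "\<not> {a<..<b} \<subseteq> V"
    using assms uncountable_open_interval countable_subset by metis
  then show ?thesis by auto
qed

text \<open>Since \<open>V\<close> is countable, cuts can be placed arbitrarily close to any point.\<close>

lemma left_cuts:
  fixes a x :: real
  assumes "countable V" "a < x"
  shows "\<exists>c::nat \<Rightarrow> real. strict_mono c \<and> c \<longlonglongrightarrow> x \<and> (\<forall>i. a < c i \<and> c i < x \<and> c i \<notin> V)"
proof -
  define l where "l i = x - (x - a) / real (Suc i)" for i
  have l_Suc: "l i < l (Suc i)" for i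
    unfolding l_def using assms(2) by (intro diff_strict_left_mono divide_strict_left_mono) auto
  have l0: "l 0 = a" by (simp add: l_def)
  have l_less: "l i < x" for i using assms(2) by (simp add: l_def)
  have "\<forall>i. \<exists>c. l i < c \<and> c < l (Suc i) \<and> c \<notin> V" using countable_avoid[OF assms(1) l_Suc] by blast
  from choice[OF this] obtain c where c: "\<And>i. l i < c i \<and> c i < l (Suc i) \<and> c i \<notin> V" by blast
  have "(\<lambda>i. (x - a) / real (Suc i)) \<longlonglongrightarrow> 0"
    by (rule LIMSEQ_Suc[OF lim_const_over_n])
  then have "(\<lambda>i. x - (x - a) / real (Suc i)) \<longlonglongrightarrow> x - 0" by (intro tendsto_diff tendsto_const)
  then have lim: "l \<longlonglongrightarrow> x" by (simp add: l_def[abs_def])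
  have "c \<longlonglongrightarrow> x"
  proof (rule tendsto_sandwich[OF _ _ lim tendsto_const])
    show "\<forall>\<^sub>F i in sequentially. l i \<le> c i" using c by (intro always_eventually) (auto intro: less_imp_le)
    show "\<forall>\<^sub>F i in sequentially. c i \<le> x"
      using c l_less by (intro always_eventually) (meson less_imp_le less_trans)
  qed
  moreover have "strict_mono c" unfolding strict_mono_Suc_iff using c by (meson less_trans)
  moreover have "a < c i \<and> c i < x \<and> c i \<notin> V" for i
  proof -
    have "l 0 \<le> l i" by (rule lift_Suc_mono_le[of l]) (use l_Suc less_imp_le in auto)
    then show ?thesis using c[of i] l_less[of "Suc i"] l0 by auto
  qed
  ultimately show ?thesis by blast
qed

lemma right_cuts:
  fixes b x :: real
  assumes "countable V" "x < b"
  shows "\<exists>c::nat \<Rightarrow> real. (\<forall>i. c (Suc i) < c i) \<and> c \<longlonglongrightarrow> x \<and> (\<forall>i. x < c i \<and> c i < b \<and> c i \<notin> V)"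
proof -
  obtain c :: "nat \<Rightarrow> real" where c: "strict_mono c" "c \<longlonglongrightarrow> - x"
    "\<And>i. - b < c i \<and> c i < - x \<and> c i \<notin> uminus ` V"
    using left_cuts[of "uminus ` V" "- b" "- x"] assms by auto
  have "(\<lambda>i. - c i) \<longlonglongrightarrow> x" using tendsto_minus[OF c(2)] by simp
  moreover have "x < - c i \<and> - c i < b \<and> - c i \<notin> V" for i
    using c(3)[of i] by (auto simp: image_iff)
  moreover have "- c (Suc i) < - c i" for i using c(1) by (simp add: strict_mono_Suc_iff)
  ultimately show ?thesis by (intro exI[of _ "\<lambda>i. - c i"]) auto
qed

text \<open>If all intervals on either side of \<open>x\<close> can be decomposed, then so can the intervals around \<open>x\<close>: cut both
  sides into sequences of pieces, and drop the finitely many pieces that are not recurrent.\<close>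

lemma decomposable_around_point:
  assumes bqo: "bqo_on Q le" and ran: "ran A \<subseteq> Q" and V: "countable (dom A)"
    and x: "x \<in> dom A" and ab: "a \<notin> dom A" "b \<notin> dom A" "a < x" "x < b"
    and left: "\<And>u v. \<lbrakk>a \<le> u; u < v; v < x; u \<notin> dom A; v \<notin> dom A\<rbrakk> \<Longrightarrow> decomposable le (A |` {u<..<v})"
    and right: "\<And>u v. \<lbrakk>x < u; u < v; v \<le> b; u \<notin> dom A; v \<notin> dom A\<rbrakk> \<Longrightarrow> decomposable le (A |` {u<..<v})"
  shows "decomposable le (A |` {a<..<b})"
proof -
  obtain c :: "nat \<Rightarrow> real" where c: "strict_mono c" "c \<longlonglongrightarrow> x" "\<And>i. a < c i \<and> c i < x \<and> c i \<notin> dom A"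
    using left_cuts[OF V ab(3)] by auto
  obtain e :: "nat \<Rightarrow> real" where e: "\<And>i. e (Suc i) < e i" "e \<longlonglongrightarrow> x" "\<And>i. x < e i \<and> e i < b \<and> e i \<notin> dom A"
    using right_cuts[OF V ab(4)] by auto
  have rec: "\<exists>N. \<forall>i\<ge>N. \<forall>n. \<exists>j\<ge>n. lobject_le le (p i) (p j)"
    if "\<And>i. p i \<in> lobjects Q le" for p :: "nat \<Rightarrow> 'a lobject"
  proof (rule eventually_recurrent[where U = "lobjects Q le" and R = "lobject_le le" and p = p])
    show "\<exists>n k. n < k \<and> lobject_le le (r n) (r k)" if "\<And>n. r n \<in> lobjects Q le" for r :: "nat \<Rightarrow> 'a lobject"
      by (rule no_bad_array_imp_good_pair[where R = "lobject_le le" and p = r,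
            OF no_bad_lobject_array[OF bqo] that])
  qed (rule that)
  have inU: "t \<in> lobjects Q le" if "valid le t" "lmap t = A |` S" for t S
    using that ran order_trans[OF ran_restrict_subset ran] by (simp add: lobjects_def)
  have "decomposable le (A |` {c i<..<c (Suc i)})" for i
    using c(3)[of i] c(3)[of "Suc i"] strict_monoD[OF c(1), of i "Suc i"] by (intro left) auto
  then have "\<forall>i. \<exists>t. valid le t \<and> lmap t = A |` {c i<..<c (Suc i)}"
    unfolding decomposable_def by blast
  from choice[OF this] obtain p where p: "\<And>i. valid le (p i) \<and> lmap (p i) = A |` {c i<..<c (Suc i)}" by blast
  obtain N where N: "\<And>i n. i \<ge> N \<Longrightarrow> \<exists>j\<ge>n. lobject_le le (p i) (p j)"
    using rec[of p] inU p by blast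
  have "decomposable le (A |` {e (Suc i)<..<e i})" for i
    using e(3)[of i] e(3)[of "Suc i"] e(1)[of i] by (intro right) auto
  then have "\<forall>i. \<exists>t. valid le t \<and> lmap t = A |` {e (Suc i)<..<e i}"
    unfolding decomposable_def by blast
  from choice[OF this] obtain q where q: "\<And>i. valid le (q i) \<and> lmap (q i) = A |` {e (Suc i)<..<e i}" by blast
  obtain M where M: "\<And>i n. i \<ge> M \<Longrightarrow> \<exists>j\<ge>n. lobject_le le (q i) (q j)"
    using rec[of q] inU q by blast
  have "decomposable le (A |` {a<..<c N})" using c(3) ab by (intro left) auto
  then obtain t0 where t0: "valid le t0" "lmap t0 = A |` {a<..<c N}" unfolding decomposable_def by blast
  have "decomposable le (A |` {e M<..<b})" using e(3) ab by (intro right) auto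
  then obtain t3 where t3: "valid le t3" "lmap t3 = A |` {e M<..<b}" unfolding decomposable_def by blast
  define c' where "c' i = c (i + N)" for i
  define e' where "e' i = e (i + M)" for i
  define ch where "ch k i = (if k = 0 then t0 else if k = 1 then p (i + N)
    else if k = 2 then q (i + M) else t3)" for k i :: nat
  define B where "B = A |` {a<..<b}"
  have "valid le (Node B x ch)"
  proof (rule valid_Node)
    show "x \<in> dom B" using x ab by (simp add: B_def)
    have "strict_mono c'" using c(1) by (simp add: strict_mono_def c'_def)
    then have "incseq c'" by (rule strict_mono_mono)
    moreover have "decseq e'" using e(1) by (simp add: decseq_Suc_iff e'_def less_imp_le)
    ultimately show "cuts (dom B) x c' e'"
      using c(3) e(3) LIMSEQ_ignore_initial_segment[OF c(2), of N] LIMSEQ_ignore_initial_segment[OF e(2), of M]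
      by (simp add: cuts_def c'_def[abs_def] e'_def[abs_def] B_def)
    show "valid le (ch k i)" for k i using t0 t3 p q by (simp add: ch_def)
    have far: "\<exists>j\<ge>n. lobject_le le (r i) (r (j + N'))"
      if r: "\<exists>j\<ge>n + N'. lobject_le le (r i) (r j)" for r :: "nat \<Rightarrow> 'a lobject" and n N' i
    proof -
      obtain j where "j \<ge> n + N'" "lobject_le le (r i) (r j)" using r by blast
      then show ?thesis by (intro exI[of _ "j - N'"]) auto
    qed
    show "recurrent (smc_embeddable le) (\<lambda>i. lmap (ch k i))" if k: "k \<in> {1, 2}" for k
      unfolding recurrent_def
    proof (intro allI)
      fix i n
      show "\<exists>j\<ge>n. lobject_le le (ch k i) (ch k j)"
        using k far[OF N[of "i + N" "n + N"]] far[OF M[of "i + M" "n + M"]] by (auto simp: ch_def)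
    qed
    fix k i :: nat
    consider "k = 0" | "k = 1" | "k = 2" | "k \<ge> 3" by linarith
    then show "lmap (ch k i) = B |` piece c' e' k i"
    proof cases
      case 1
      have "A |` {a<..<c N} = A |` ({a<..<b} \<inter> {..<c N})"
        using c(3)[of N] ab by (intro restrict_map_eqI) auto
      then show ?thesis using 1 t0 by (simp add: ch_def B_def piece_def c'_def)
    next
      case 2
      have "A |` {c (i + N)<..<c (Suc (i + N))} = A |` ({a<..<b} \<inter> {c (i + N)<..<c (Suc (i + N))})"
        using c(3)[of "i + N"] c(3)[of "Suc (i + N)"] ab by (intro restrict_map_eqI) auto
      then show ?thesis using 2 p by (simp add: ch_def B_def piece_def c'_def)
    next
      case 3
      have "A |` {e (Suc (i + M))<..<e (i + M)} = A |` ({a<..<b} \<inter> {e (Suc (i + M))<..<e (i + M)})"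
        using e(3)[of "i + M"] e(3)[of "Suc (i + M)"] ab by (intro restrict_map_eqI) auto
      then show ?thesis using 3 q by (simp add: ch_def B_def piece_def e'_def)
    next
      case 4
      have "A |` {e M<..<b} = A |` ({a<..<b} \<inter> {e M<..})"
        using e(3)[of M] ab by (intro restrict_map_eqI) auto
      then show ?thesis using 4 t3 by (simp add: ch_def B_def piece_def e'_def)
    qed
  qed
  then show ?thesis unfolding decomposable_def B_def[symmetric] by (intro exI[of _ "Node B x ch"]) simp
qed

lemma countable_closed_isolated_point:
  fixes Z :: "real set"
  assumes Z: "closed Z" "countable Z" "Z \<noteq> {}"
  shows "\<exists>x\<in>Z. \<not> x islimpt Z"
proof (rule ccontr)
  assume "\<not> ?thesis"
  then have lim: "z islimpt Z" if "z \<in> Z" for z using that by blast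
  have "Z \<subseteq> closure (\<Inter>((\<lambda>z. Z - {z}) ` Z))"
  proof (rule Baire[OF Z(1)])
    show "countable ((\<lambda>z. Z - {z}) ` Z)" using Z(2) by simp
    fix T assume "T \<in> (\<lambda>z. Z - {z}) ` Z"
    then obtain z where z: "z \<in> Z" "T = Z - {z}" by blast
    have "openin (top_of_set Z) (Z - {z})" by (simp add: openin_delete)
    moreover have "z \<in> closure (Z - {z})"
      using lim[OF z(1)] by (simp add: islimpt_in_closure)
    then have "Z \<subseteq> closure (Z - {z})" using closure_subset[of "Z - {z}"] by blast
    ultimately show "openin (top_of_set Z) T \<and> Z \<subseteq> closure T" using z(2) by simp
  qed
  moreover have "\<Inter>((\<lambda>z. Z - {z}) ` Z) = {}" using Z(3) by blast
  ultimately show False using Z(3) by simp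
qed

text \<open>All small intervals around \<open>x\<close> whose end points avoid the domain can be decomposed.\<close>

definition good_point :: "('a \<Rightarrow> 'a \<Rightarrow> bool) \<Rightarrow> (real \<rightharpoonup> 'a) \<Rightarrow> real \<Rightarrow> bool" where
  "good_point le A x \<longleftrightarrow> (\<exists>\<delta>>0. \<forall>u v. x - \<delta> < u \<and> u < v \<and> v < x + \<delta> \<and> u \<notin> dom A \<and> v \<notin> dom A \<longrightarrow>
     decomposable le (A |` {u<..<v}))"

text \<open>Good points along a compact interval suffice, by bisection.\<close>

lemma decomposable_interval:
  assumes V: "countable (dom A)" and good: "\<And>x. \<lbrakk>a \<le> x; x \<le> b\<rbrakk> \<Longrightarrow> good_point le A x"
    and ab: "a < b" "a \<notin> dom A" "b \<notin> dom A"
  shows "decomposable le (A |` {a<..<b})"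
proof -
  \<comment> \<open>The slack \<open>\<eta>\<close> makes \<open>P\<close> additive although the point of division may lie in the domain.\<close>
  define P where "P s t \<longleftrightarrow> (\<exists>\<eta>>0. \<forall>u v. s - \<eta> < u \<and> u < v \<and> v < t + \<eta> \<and> u \<notin> dom A \<and> v \<notin> dom A \<longrightarrow>
      decomposable le (A |` {u<..<v}))" for s t
  have "P a b"
    using less_imp_le[OF ab(1)]
  proof (induction rule: Bolzano)
    case (trans s m t)
    obtain \<eta>1 where \<eta>1: "\<eta>1 > 0"
      "\<And>u v. \<lbrakk>s - \<eta>1 < u; u < v; v < m + \<eta>1; u \<notin> dom A; v \<notin> dom A\<rbrakk> \<Longrightarrow> decomposable le (A |` {u<..<v})"
      using trans(1) unfolding P_def by blast
    obtain \<eta>2 where \<eta>2: "\<eta>2 > 0"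
      "\<And>u v. \<lbrakk>m - \<eta>2 < u; u < v; v < t + \<eta>2; u \<notin> dom A; v \<notin> dom A\<rbrakk> \<Longrightarrow> decomposable le (A |` {u<..<v})"
      using trans(2) unfolding P_def by blast
    have "decomposable le (A |` {u<..<v})"
      if uv: "s - min \<eta>1 \<eta>2 < u" "u < v" "v < t + min \<eta>1 \<eta>2" "u \<notin> dom A" "v \<notin> dom A" for u v
    proof -
      consider "v < m + \<eta>1" | "m - \<eta>2 < u" | "m + \<eta>1 \<le> v" "u \<le> m - \<eta>2" by linarith
      then show ?thesis
      proof cases
        case 1
        then show ?thesis using uv by (intro \<eta>1(2)) auto
      next
        case 2
        then show ?thesis using uv by (intro \<eta>2(2)) auto
      next
        case 3
        obtain w where w: "m - \<eta>2 < w" "w < m + \<eta>1" "w \<notin> dom A"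
          using countable_avoid[OF V, of "m - \<eta>2" "m + \<eta>1"] \<eta>1(1) \<eta>2(1) by auto
        show ?thesis
        proof (rule decomposable_append[OF _ _ w(3)])
          show "decomposable le (A |` {u<..<w})" using uv w 3 by (intro \<eta>1(2)) auto
          show "decomposable le (A |` {w<..<v})" using uv w 3 by (intro \<eta>2(2)) auto
        qed (use w 3 in auto)
      qed
    qed
    then show ?case unfolding P_def using \<eta>1(1) \<eta>2(1) by (intro exI[of _ "min \<eta>1 \<eta>2"]) auto
  next
    case (local x)
    obtain \<delta> where \<delta>: "\<delta> > 0"
      "\<And>u v. \<lbrakk>x - \<delta> < u; u < v; v < x + \<delta>; u \<notin> dom A; v \<notin> dom A\<rbrakk> \<Longrightarrow> decomposable le (A |` {u<..<v})"
      using good[OF local] unfolding good_point_def by blast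
    have "P s t" if st: "s \<le> x" "x \<le> t" "t - s < \<delta> / 2" for s t
      unfolding P_def
    proof (intro exI[of _ "\<delta> / 2"] conjI allI impI)
      fix u v assume "s - \<delta> / 2 < u \<and> u < v \<and> v < t + \<delta> / 2 \<and> u \<notin> dom A \<and> v \<notin> dom A"
      then show "decomposable le (A |` {u<..<v})" using st \<delta>(1) by (intro \<delta>(2)) auto
    qed (use \<delta>(1) in simp)
    then show ?case using \<delta>(1) by (intro exI[of _ "\<delta> / 2"]) auto
  qed
  then obtain \<eta> where "\<eta> > 0"
    "\<And>u v. \<lbrakk>a - \<eta> < u; u < v; v < b + \<eta>; u \<notin> dom A; v \<notin> dom A\<rbrakk> \<Longrightarrow> decomposable le (A |` {u<..<v})"
    unfolding P_def by blast
  then show ?thesis using ab by simp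
qed

theorem bounded_cclo_decomposable:
  assumes bqo: "bqo_on Q le" and ran: "ran A \<subseteq> Q" and V: "countable (dom A)" "closed (dom A)"
    and bd: "dom A \<subseteq> {a<..<b}"
  shows "decomposable le A"
proof (cases "a < b")
  case False
  then show ?thesis using bd decomposable_empty[of A] by auto
next
  case True
  \<comment> \<open>The set of bad points is closed and countable; an isolated bad point would be good.\<close>
  define Z where "Z = {x. \<not> good_point le A x}"
  have Z_sub: "Z \<subseteq> dom A"
  proof
    fix x assume x: "x \<in> Z"
    show "x \<in> dom A"
    proof (rule ccontr)
      assume "x \<notin> dom A"
      then have "x \<in> - dom A" by simp
      then obtain \<delta> where \<delta>: "\<delta> > 0" "ball x \<delta> \<subseteq> - dom A"
        using open_Compl[OF V(2)] unfolding open_contains_ball by blast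
      have "decomposable le (A |` {u<..<v})" if "x - \<delta> < u" "v < x + \<delta>" for u v
      proof (rule decomposable_empty)
        have "{u<..<v} \<subseteq> ball x \<delta>" using that by (auto simp: dist_real_def)
        then show "dom (A |` {u<..<v}) = {}" using \<delta>(2) by auto
      qed
      then have "good_point le A x" unfolding good_point_def using \<delta>(1) by blast
      then show False using x by (simp add: Z_def)
    qed
  qed
  have "open (- Z)"
    unfolding open_dist
  proof
    fix x assume "x \<in> - Z"
    then have "good_point le A x" by (simp add: Z_def)
    then obtain \<delta> where \<delta>: "\<delta> > 0"
      "\<And>u v. \<lbrakk>x - \<delta> < u; u < v; v < x + \<delta>; u \<notin> dom A; v \<notin> dom A\<rbrakk> \<Longrightarrow> decomposable le (A |` {u<..<v})"
      unfolding good_point_def by blast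
    have "y \<in> - Z" if "dist y x < \<delta> / 2" for y
    proof -
      have "decomposable le (A |` {u<..<v})"
        if "y - \<delta> / 2 < u \<and> u < v \<and> v < y + \<delta> / 2 \<and> u \<notin> dom A \<and> v \<notin> dom A" for u v
        using that \<open>dist y x < \<delta> / 2\<close> by (intro \<delta>(2)) (auto simp: dist_real_def)
      then show ?thesis unfolding Z_def good_point_def using \<delta>(1) half_gt_zero by blast
    qed
    then show "\<exists>e>0. \<forall>y. dist y x < e \<longrightarrow> y \<in> - Z" using \<delta>(1) half_gt_zero by blast
  qed
  then have closedZ: "closed Z" by (simp add: closed_def)
  have "Z = {}"
  proof (rule ccontr)
    assume "Z \<noteq> {}"
    then obtain x where x: "x \<in> Z" "\<not> x islimpt Z"
      using countable_closed_isolated_point[OF closedZ countable_subset[OF Z_sub V(1)]] by blast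
    then obtain \<epsilon> where \<epsilon>: "\<epsilon> > 0" and iso: "\<And>y. \<lbrakk>y \<in> Z; y \<noteq> x\<rbrakk> \<Longrightarrow> \<not> dist y x < \<epsilon>"
      unfolding islimpt_approachable by blast
    have good: "good_point le A y" if "x - \<epsilon> < y" "y < x + \<epsilon>" "y \<noteq> x" for y
    proof -
      have "dist y x < \<epsilon>" using that(1,2) by (simp add: dist_real_def abs_less_iff)
      then show ?thesis using iso[of y] that(3) by (auto simp: Z_def)
    qed
    have xV: "x \<in> dom A" using x(1) Z_sub by blast
    have one_side: "decomposable le (A |` {u<..<v})"
      if "x - \<epsilon> < u" "u < v" "v < x + \<epsilon>" "u \<notin> dom A" "v \<notin> dom A" "v < x \<or> x < u" for u v
      using that by (intro decomposable_interval[OF V(1)] good) auto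
    have "decomposable le (A |` {u<..<v})"
      if uv: "x - \<epsilon> < u" "u < v" "v < x + \<epsilon>" "u \<notin> dom A" "v \<notin> dom A" for u v
    proof (cases "v < x \<or> x < u")
      case True
      then show ?thesis using one_side uv by blast
    next
      case False
      moreover have "u \<noteq> x" "v \<noteq> x" using uv(4,5) xV by auto
      ultimately have "u < x" "x < v" by auto
      from uv(4,5) this show ?thesis
      proof (rule decomposable_around_point[OF bqo ran V(1) xV])
        show "decomposable le (A |` {u'<..<v'})"
          if "u \<le> u'" "u' < v'" "v' < x" "u' \<notin> dom A" "v' \<notin> dom A" for u' v'
          using that uv(1) \<epsilon> by (intro one_side) auto
        show "decomposable le (A |` {u'<..<v'})"
          if "x < u'" "u' < v'" "v' \<le> v" "u' \<notin> dom A" "v' \<notin> dom A" for u' v'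
          using that uv(3) \<epsilon> by (intro one_side) auto
      qed
    qed
    then have "good_point le A x" unfolding good_point_def using \<epsilon> by blast
    then show False using x(1) by (simp add: Z_def)
  qed
  then have "decomposable le (A |` {a<..<b})"
    using True bd by (intro decomposable_interval[OF V(1)]) (auto simp: Z_def)
  moreover have "A |` {a<..<b} = A"
  proof -
    have "A |` {a<..<b} = A |` UNIV" using bd by (intro restrict_map_eqI) auto
    then show ?thesis by (simp add: restrict_map_def)
  qed
  ultimately show ?thesis by simp
qed

section \<open>Unbounded sets and the theorem\<close>

text \<open>The labelled set moved to the interval from \<open>- pi / 2\<close> to \<open>pi / 2\<close> by the arc tangent, with both end points
  added.  Any label \<open>q\<close> serves for the end points, because an embedding sends the other points
  strictly between the images of the end points, hence to points that are not end points.\<close>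

definition compactification :: "'a \<Rightarrow> (real \<rightharpoonup> 'a) \<Rightarrow> real \<rightharpoonup> 'a" where
  "compactification q A = (\<lambda>y. if \<bar>y\<bar> = pi / 2 then Some q
     else if \<bar>y\<bar> < pi / 2 then A (tan y) else None)"

lemma dom_compactification:
  "dom (compactification q A) = {y. \<bar>y\<bar> = pi / 2 \<or> \<bar>y\<bar> < pi / 2 \<and> tan y \<in> dom A}"
  by (auto simp: compactification_def split: if_splits)

lemma abs_arctan_less: "\<bar>arctan r\<bar> < pi / 2"
  using arctan_lbound[of r] arctan_ubound[of r] by linarith

lemma dom_compactification_image:
  "dom (compactification q A) = {- (pi / 2), pi / 2} \<union> arctan ` dom A" (is "_ = ?R")
proof -
  have 1: "y \<in> arctan ` dom A \<longleftrightarrow> \<bar>y\<bar> < pi / 2 \<and> tan y \<in> dom A" for y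
  proof
    assume "y \<in> arctan ` dom A"
    then show "\<bar>y\<bar> < pi / 2 \<and> tan y \<in> dom A"
      using abs_arctan_less by (auto simp: tan_arctan)
  next
    assume y: "\<bar>y\<bar> < pi / 2 \<and> tan y \<in> dom A"
    then have "arctan (tan y) = y" by (intro arctan_tan) auto
    then show "y \<in> arctan ` dom A" using y by (metis image_eqI)
  qed
  have 2: "\<bar>y\<bar> = pi / 2 \<longleftrightarrow> y = - (pi / 2) \<or> y = pi / 2" for y :: real
    using pi_gt_zero by arith
  show ?thesis unfolding dom_compactification set_eq_iff Un_iff insert_iff mem_Collect_eq 1 2 by simp
qed

lemma compactification_arctan [simp]: "compactification q A (arctan r) = A r"
  using abs_arctan_less[of r] by (simp add: compactification_def tan_arctan)

lemma closed_dom_compactification: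
  assumes "closed (dom A)" shows "closed (dom (compactification q A))"
proof -
  have "open {y \<in> {- (pi / 2)<..<pi / 2}. tan y \<in> - dom A}"
  proof -
    have "open ({- (pi / 2)<..<pi / 2} \<inter> tan -` (- dom A))"
      using assms cos_gt_zero_pi
      by (intro continuous_open_preimage continuous_intros) (fastforce simp: closed_def)+
    then show ?thesis by (simp add: Int_def vimage_def)
  qed
  then have "open ({..<- (pi / 2)} \<union> {pi / 2<..} \<union> {y \<in> {- (pi / 2)<..<pi / 2}. tan y \<in> - dom A})"
    by (intro open_Un) auto
  moreover have "- dom (compactification q A) =
      {..<- (pi / 2)} \<union> {pi / 2<..} \<union> {y \<in> {- (pi / 2)<..<pi / 2}. tan y \<in> - dom A}"
    unfolding dom_compactification by (auto simp: abs_if)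
  ultimately show ?thesis by (simp add: closed_def)
qed

lemma smc_embeddable_compactification:
  assumes "smc_embeddable le (compactification q A) (compactification q B)"
  shows "smc_embeddable le A B"
proof -
  let ?A = "compactification q A" and ?B = "compactification q B"
  obtain h where h: "label_embedding le ?A (dom ?A) ?B (dom ?B) h"
    using assms unfolding smc_embeddable_iff by blast
  have ends: "- (pi / 2) \<in> dom ?A" "pi / 2 \<in> dom ?A" and sub: "arctan ` dom A \<subseteq> dom ?A"
    by (auto simp: dom_compactification_image)
  have h_bounds: "- (pi / 2) < h (arctan r)" "h (arctan r) < pi / 2" if r: "r \<in> dom A" for r
  proof -
    have r': "arctan r \<in> dom ?A" using sub r by blast
    have bound: "\<bar>h y\<bar> \<le> pi / 2" if "y \<in> dom ?A" for y
      using label_embeddingD(1)[OF h that] unfolding dom_compactification by auto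
    have "- (pi / 2) \<le> h (- (pi / 2))" "h (pi / 2) \<le> pi / 2"
      using bound[OF ends(1)] bound[OF ends(2)] by linarith+
    then show "- (pi / 2) < h (arctan r)" "h (arctan r) < pi / 2"
      using label_embeddingD(4)[OF h ends(1) r'] label_embeddingD(4)[OF h r' ends(2)] arctan_bounded[of r]
      by auto
  qed
  have B: "?B (h (arctan r)) = B (tan (h (arctan r)))" if "r \<in> dom A" for r
    using h_bounds[OF that] by (auto simp: compactification_def abs_if)
  have "label_embedding le A (dom A) B (dom B) (\<lambda>r. tan (h (arctan r)))"
  proof (rule label_embeddingI)
    fix r assume r: "r \<in> dom A"
    then have r': "arctan r \<in> dom ?A" using sub by blast
    note hr = label_embeddingD[OF h r']
    show "tan (h (arctan r)) \<in> dom B" using hr(1) B[OF r] by (auto simp: domIff)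
    show "le (the (A r)) (the (B (tan (h (arctan r)))))" using hr(2) B[OF r] by simp
    show "tan (h (arctan r)) < tan (h (arctan s))" if "s \<in> dom A" "r < s" for s
      using h_bounds[OF r] h_bounds[OF that(1)] hr(4)[of "arctan s"] that sub
      by (intro tan_monotone) (auto simp: arctan_less_iff)
    have "(arctan \<longlongrightarrow> arctan r) (at r within dom A)" by (intro tendsto_intros)
    moreover have "(h \<longlongrightarrow> h (arctan r)) (at (arctan r) within arctan ` dom A)"
      using hr(3) sub by (rule tendsto_within_subset)
    ultimately have "((\<lambda>r. h (arctan r)) \<longlongrightarrow> h (arctan r)) (at r within dom A)"
      by (rule tendsto_compose_within)
    moreover have "cos (h (arctan r)) \<noteq> 0" using cos_gt_zero_pi[OF h_bounds[OF r]] by simp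
    ultimately show "((\<lambda>r. tan (h (arctan r))) \<longlongrightarrow> tan (h (arctan r))) (at r within dom A)"
      by (rule tendsto_tan)
  qed
  then show ?thesis unfolding smc_embeddable_iff by blast
qed

theorem corollary23:
  fixes Q :: "'a set" and le :: "'a \<Rightarrow> 'a \<Rightarrow> bool"
  assumes "bqo_on Q le"
  shows "wqo_on (labelled_cclos Q) (smc_embeddable le)"
proof -
  have refl: "reflp_on Q le" and tr: "transp_on Q le"
    using assms by (auto simp: bqo_on_def quasi_order_on_def)
  have "quasi_order_on (labelled_cclos Q) (smc_embeddable le)"
    unfolding quasi_order_on_def
  proof
    show "reflp_on (labelled_cclos Q) (smc_embeddable le)"
      using smc_embeddable_refl[OF refl] by (auto simp: reflp_on_def labelled_cclos_def)
    show "transp_on (labelled_cclos Q) (smc_embeddable le)"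
      using smc_embeddable_trans[OF tr] unfolding transp_on_def labelled_cclos_def by blast
  qed
  moreover have "\<exists>n k. n < k \<and> smc_embeddable le (p n) (p k)"
    if p: "\<And>n. p n \<in> labelled_cclos Q" for p :: "nat \<Rightarrow> real \<rightharpoonup> 'a"
  proof (cases "Q = {}")
    case True
    then have "ran (p 0) = {}" using p[of 0] by (simp add: labelled_cclos_def)
    then have "p 0 a = None" for a by (cases "p 0 a") (auto simp: ran_def)
    then have "dom (p 0) = {}" by (simp add: dom_def)
    then have "smc_embeddable le (p 0) (p 1)" by (rule smc_embeddable_empty)
    with zero_less_one[where 'a = nat] show ?thesis by blast
  next
    case False
    then obtain q where q: "q \<in> Q" by blast
    have "\<exists>t. t \<in> lobjects Q le \<and> lmap t = compactification q (p n)" for n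
    proof -
      have cp: "countable (dom (p n))" "closed (dom (p n))" "ran (p n) \<subseteq> Q"
        using p[of n] by (auto simp: labelled_cclos_def cclo_def)
      have ran: "ran (compactification q (p n)) \<subseteq> Q"
        using q cp(3) by (auto simp: compactification_def ran_def split: if_splits)
      have "decomposable le (compactification q (p n))"
      proof (rule bounded_cclo_decomposable[OF assms ran])
        show "countable (dom (compactification q (p n)))"
          unfolding dom_compactification_image using cp(1) by simp
        show "closed (dom (compactification q (p n)))" by (rule closed_dom_compactification[OF cp(2)])
        show "dom (compactification q (p n)) \<subseteq> {- pi<..<pi}"
        proof
          fix y assume "y \<in> dom (compactification q (p n))"
          then have "\<bar>y\<bar> \<le> pi / 2" unfolding dom_compactification by auto
          then have "- pi < y \<and> y < pi" using pi_gt_zero by linarith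
          then show "y \<in> {- pi<..<pi}" by simp
        qed
      qed
      then obtain t where "valid le t" "lmap t = compactification q (p n)"
        unfolding decomposable_def by blast
      then show ?thesis using ran by (intro exI[of _ t]) (simp add: lobjects_def)
    qed
    then have "\<forall>n. \<exists>t. t \<in> lobjects Q le \<and> lmap t = compactification q (p n)" by blast
    from choice[OF this] obtain t
      where t: "\<And>n. t n \<in> lobjects Q le" "\<And>n. lmap (t n) = compactification q (p n)" by blast
    have "\<exists>n k. n < k \<and> lobject_le le (t n) (t k)"
      by (rule no_bad_array_imp_good_pair[where p = t and R = "lobject_le le",
            OF no_bad_lobject_array[OF assms] t(1)])
    then obtain n k where nk: "n < k" "lobject_le le (t n) (t k)" by (elim exE conjE)
    from nk(2) have "smc_embeddable le (p n) (p k)"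
      unfolding t(2) by (rule smc_embeddable_compactification)
    with nk(1) show ?thesis by (rule_tac x = n in exI, rule_tac x = k in exI) simp
  qed
  ultimately show ?thesis by (simp add: wqo_on_def)
qed

end
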